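(* Suppose that $S$ is a nonreflecting stationary subset of a strongly inaccessible cardinal $\kappa$ and $\diamondsuit(S)$ holds. Then: (1) $\mathrm P^-(\kappa,\kappa,{}^S{\sqsubseteq},1,\{S\},2,\kappa)$ holds; (2) $\mathrm P^-(\kappa,\kappa,{}^S{\sqsubseteq},\kappa,\{S\},2,{<}\infty)$ holds.
   Context: $S\subseteq\kappa$ is nonreflecting if there is no $\alpha<\kappa$ of uncountable cofinality with $S\cap\alpha$ stationary in $\alpha$. $\diamondsuit(S)$: there is $\langle A_\alpha\mid\alpha\in S\rangle$ with $A_\alpha\subseteq\alpha$ such that for all $A\subseteq\kappa$, $\{\alpha\in S\mid A\cap\alpha=A_\alpha\}$ is stationary. Notation: $\mathrm{acc}(C):=\{\alpha\in C\mid\sup(C\cap\alpha)=\alpha>0\}$; $C(j)$ is the $j$-th element of $C$; $\mathrm{succ}_\sigma(C):=\{C(j+1)\mid j<\sigma,\ j+1<\mathrm{otp}(C)\}$; $\mathrm{acc}(\kappa)$ is the set of nonzero limit ordinals below $\kappa$. $\mathcal K(\kappa)$ is the set of nonempty $x\subseteq\kappa$ which are club in $\sup(x)$ with $\sup(x)\notin x$; $\alpha_C:=\sup(C)$. For $C,D\in\mathcal K(\kappa)$: $C\,{}^S{\sqsubseteq}\,D$ iff $C=D\cap\alpha_C$ and $\alpha_C\notin S$. $\mathrm P^-(\kappa,\kappa,{}^S{\sqsubseteq},\theta,\{S\},2,\sigma)$ asserts the existence of $\langle\mathcal C_\alpha\mid\alpha<\kappa\rangle$ such that for every $\alpha\in\mathrm{acc}(\kappa)$: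 $\mathcal C_\alpha\subseteq\{C\in\mathcal K(\kappa)\mid\alpha_C=\alpha\}$, $0<|\mathcal C_\alpha|<\kappa$, and for all $C\in\mathcal C_\alpha$ and $\bar\alpha\in\mathrm{acc}(C)$ there is $D\in\mathcal C_{\bar\alpha}$ with $D\,{}^S{\sqsubseteq}\,C$; and for every sequence $\langle B_i\mid i<\theta\rangle$ of cofinal subsets of $\kappa$ there are stationarily many $\alpha\in S$ with $|\mathcal C_\alpha|=1$ such that for all $C\in\mathcal C_\alpha$ and $i<\min\{\alpha,\theta\}$, $\sup\{\gamma\in C\mid\mathrm{succ}_\sigma(C\setminus\gamma)\subseteq B_i\}=\alpha$. When $\sigma={<}\infty$, the last condition is replaced by: for every $\sigma'<\mathrm{otp}(C)$, $\sup\{\gamma\in C\mid\mathrm{succ}_{\sigma'}(C\setminus\gamma)\subseteq B_i\}=\alpha$. *)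

theory Defs
  imports "HOL-Library.Countable_Set"
begin

unbundle cardinal_syntax

text \<open>Ordinals are the elements of an arbitrary well-ordered type \<open>'a\<close>. The cardinal \<open>\<kappa>\<close> under
  consideration is an element of \<open>'a\<close>, and an ordinal \<open>\<alpha>\<close>, viewed as the set of its predecessors,
  is \<open>{..<\<alpha>}\<close>. The type thus provides all ordinals up to and including \<open>\<kappa>\<close>, so that \<open>\<kappa>\<close> itself
  may serve as a supremum, an order type or a parameter. Every ordinal arises in this way, as an
  element of its successor.\<close>

definition ozero :: "'a::wellorder" where
  "ozero = (LEAST x. True)"

definition osuc :: "'a::wellorder \<Rightarrow> 'a" where
  "osuc \<alpha> = (LEAST \<beta>. \<alpha> < \<beta>)"

definition osup :: "'a::wellorder set \<Rightarrow> 'a" where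
  "osup A = (LEAST \<beta>. \<forall>a\<in>A. a \<le> \<beta>)"

definition otp :: "'a::wellorder set \<Rightarrow> 'a" where
  "otp A = (THE \<delta>. \<exists>f. bij_betw f {..<\<delta>} A \<and> strict_mono_on {..<\<delta>} f)"

text \<open>The \<open>j\<close>-th element \<open>C(j)\<close> of \<open>C\<close>, counting from \<open>0\<close>.\<close>

definition onth :: "'a::wellorder set \<Rightarrow> 'a \<Rightarrow> 'a" where
  "onth C j = (THE x. x \<in> C \<and> otp (C \<inter> {..<x}) = j)"

definition ord_rel :: "'a::wellorder \<Rightarrow> 'a rel" where
  "ord_rel \<delta> = {(x, y). x \<le> y \<and> y < \<delta>}"

definition strongly_inaccessible :: "'a::wellorder \<Rightarrow> bool" where
  "strongly_inaccessible \<kappa> \<longleftrightarrow>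
     Card_order (ord_rel \<kappa>) \<and> uncountable {..<\<kappa>} \<and> regularCard (ord_rel \<kappa>) \<and>
     (\<forall>\<mu><\<kappa>. |Pow {..<\<mu>}| <o ord_rel \<kappa>)"

definition cofinal_in :: "'a::wellorder set \<Rightarrow> 'a \<Rightarrow> bool" where
  "cofinal_in A \<delta> \<longleftrightarrow> A \<subseteq> {..<\<delta>} \<and> (\<forall>\<beta><\<delta>. \<exists>a\<in>A. \<beta> \<le> a)"

definition cof :: "'a::wellorder \<Rightarrow> 'a" where
  "cof \<delta> = (LEAST \<eta>. \<exists>A. cofinal_in A \<delta> \<and> otp A = \<eta>)"

definition club_in :: "'a::wellorder set \<Rightarrow> 'a \<Rightarrow> bool" where
  "club_in C \<delta> \<longleftrightarrow> cofinal_in C \<delta> \<and>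
     (\<forall>\<beta><\<delta>. ozero < \<beta> \<and> osup (C \<inter> {..<\<beta>}) = \<beta> \<longrightarrow> \<beta> \<in> C)"

definition stationary_in :: "'a::wellorder set \<Rightarrow> 'a \<Rightarrow> bool" where
  "stationary_in S \<delta> \<longleftrightarrow> S \<subseteq> {..<\<delta>} \<and> (\<forall>C. club_in C \<delta> \<longrightarrow> S \<inter> C \<noteq> {})"

definition nonreflecting :: "'a::wellorder \<Rightarrow> 'a set \<Rightarrow> bool" where
  "nonreflecting \<kappa> S \<longleftrightarrow>
     \<not> (\<exists>\<alpha><\<kappa>. uncountable {..<cof \<alpha>} \<and> stationary_in (S \<inter> {..<\<alpha>}) \<alpha>)"

definition diamond :: "'a::wellorder \<Rightarrow> 'a set \<Rightarrow> bool" where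
  "diamond \<kappa> S \<longleftrightarrow>
     (\<exists>A :: 'a \<Rightarrow> 'a set. (\<forall>\<alpha>\<in>S. A \<alpha> \<subseteq> {..<\<alpha>}) \<and>
        (\<forall>X \<subseteq> {..<\<kappa>}. stationary_in {\<alpha>\<in>S. X \<inter> {..<\<alpha>} = A \<alpha>} \<kappa>))"

text \<open>In particular \<open>acc {..<\<kappa>}\<close> is the set of nonzero limit ordinals below \<open>\<kappa>\<close>.\<close>

definition acc :: "'a::wellorder set \<Rightarrow> 'a set" where
  "acc C = {\<alpha>\<in>C. osup (C \<inter> {..<\<alpha>}) = \<alpha> \<and> ozero < \<alpha>}"

definition succ_set :: "'a::wellorder \<Rightarrow> 'a set \<Rightarrow> 'a set" where
  "succ_set \<sigma> C = {onth C (osuc j) | j. j < \<sigma> \<and> osuc j < otp C}"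

definition K_set :: "'a::wellorder \<Rightarrow> 'a set set" where
  "K_set \<kappa> = {x. x \<noteq> {} \<and> x \<subseteq> {..<\<kappa>} \<and> club_in x (osup x) \<and> osup x \<notin> x}"

definition sq_initial :: "'a::wellorder set \<Rightarrow> 'a set \<Rightarrow> 'a set \<Rightarrow> bool" where
  "sq_initial S C D \<longleftrightarrow> C = D \<inter> {..<osup C} \<and> osup C \<notin> S"

text \<open>Values of the last parameter of the proxy principle: an ordinal \<open>\<sigma>\<close>, or \<open><\<infinity>\<close>.\<close>

datatype 'a sigma_param = Sigma_ord 'a | Sigma_lt_infty

fun hits :: "'a::wellorder sigma_param \<Rightarrow> 'a set \<Rightarrow> 'a set \<Rightarrow> 'a \<Rightarrow> bool" where
  "hits (Sigma_ord \<sigma>) C B \<alpha> \<longleftrightarrow>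
     osup {\<gamma>\<in>C. succ_set \<sigma> (C - {..<\<gamma>}) \<subseteq> B} = \<alpha>"
| "hits Sigma_lt_infty C B \<alpha> \<longleftrightarrow>
     (\<forall>\<sigma>' < otp C. osup {\<gamma>\<in>C. succ_set \<sigma>' (C - {..<\<gamma>}) \<subseteq> B} = \<alpha>)"

text \<open>The principle \<open>P\<^sup>-(\<kappa>, \<kappa>, \<^sup>S\<sqsubseteq>, \<theta>, {S}, 2, \<sigma>)\<close>.\<close>

definition P_minus :: "'a::wellorder \<Rightarrow> 'a set \<Rightarrow> 'a \<Rightarrow> 'a sigma_param \<Rightarrow> bool" where
  "P_minus \<kappa> S \<theta> \<sigma> \<longleftrightarrow>
     (\<exists>\<C> :: 'a \<Rightarrow> 'a set set.
        (\<forall>\<alpha>\<in>acc {..<\<kappa>}.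
           \<C> \<alpha> \<subseteq> {C \<in> K_set \<kappa>. osup C = \<alpha>} \<and>
           \<C> \<alpha> \<noteq> {} \<and> |\<C> \<alpha>| <o ord_rel \<kappa> \<and>
           (\<forall>C\<in>\<C> \<alpha>. \<forall>\<alpha>'\<in>acc C. \<exists>D\<in>\<C> \<alpha>'. sq_initial S D C)) \<and>
        (\<forall>B :: 'a \<Rightarrow> 'a set. (\<forall>i<\<theta>. cofinal_in (B i) \<kappa>) \<longrightarrow>
           stationary_in
             {\<alpha>\<in>S. card (\<C> \<alpha>) = 1 \<and> (\<forall>C\<in>\<C> \<alpha>. \<forall>i<min \<alpha> \<theta>. hits \<sigma> C (B i) \<alpha>)} \<kappa>))"

end

theory Submission
  imports Defs
begin

text \<open>Since \<open>\<kappa>\<close> is a strong limit, outside \<open>S\<close> one may take for \<open>\<C> \<alpha>\<close> the family of all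
  clubs in \<open>\<alpha>\<close> whose accumulation points avoid \<open>S\<close>; such clubs exist as \<open>S\<close> does not reflect, and coherence is
  automatic. At \<open>\<alpha> \<in> S\<close> a single such club is chosen according to the diamond sequence.
  For (1), a club avoiding \<open>S\<close> is thinned out so that its successor elements lie in the guessed set.
  For (2), nonreflection below ordinals of large cofinality yields arbitrarily long closed sets
  which avoid \<open>S\<close> and whose successor elements lie in a given \<open>B i\<close>; club many \<open>\<alpha>\<close> are closed
  under the choice of such blocks, and between consecutive points of a sparse club in \<open>\<alpha>\<close> one
  inserts blocks for all smaller \<open>i\<close> at once, which also works when \<open>\<alpha>\<close> has small cofinality.\<close>

section \<open>Suprema and limit points\<close>

text \<open>Limit points must avoid \<open>S\<close> because \<open>sq_initial\<close> demands it
  and because at points of \<open>S\<close> only one club survives, with which other clubs could not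
  be expected to cohere. At \<alpha> in \<open>S\<close> that single club needs, for each of the
  |\<alpha>| many indices i, cofinally many runs of successors in \<open>B i\<close> of every length
  below its own order type. A club of short order type may lack room for so many runs, while a long
  one needs long runs, and these pass through limit points that have to miss \<open>S\<close>. Since
  \<alpha> itself may have countable cofinality, long runs are produced below auxiliary ordinals
  \<delta> < \<kappa> of large cofinality: every cofinal set there is large, and nonreflection keeps
  the limit points of a suitable one off \<open>S\<close>. The \<kappa> many sets \<open>B i\<close>
  are coded into one subset of \<kappa> by an injection of \<kappa> \<times> \<kappa>, so that a
  single guess provides all of them below \<alpha>.\<close>

definition limpt :: "'a::wellorder set \<Rightarrow> 'a \<Rightarrow> bool" where
  "limpt X \<beta> \<longleftrightarrow> (\<exists>x. x < \<beta>) \<and> (\<forall>x<\<beta>. \<exists>y\<in>X. x < y \<and> y < \<beta>)"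

definition limit_ord :: "'a::wellorder \<Rightarrow> bool" where
  "limit_ord \<alpha> \<longleftrightarrow> (\<exists>x. x < \<alpha>) \<and> (\<forall>x<\<alpha>. \<exists>y<\<alpha>. x < y)"

lemma ozero_le: "ozero \<le> x"
  unfolding ozero_def by (rule Least_le) simp

lemma ozero_less_iff: "ozero < \<beta> \<longleftrightarrow> (\<exists>x. x < \<beta>)"
  using ozero_le by (metis order_le_less_trans)

text \<open>\<open>osuc x\<close> and \<open>osup A\<close> are meaningful only if something lies
  above \<open>x\<close> or bounds \<open>A\<close>; the witness \<open>y\<close> here and the bound
  \<open>u\<close> below record this.\<close>

lemma less_osuc: "x < y \<Longrightarrow> x < osuc x"
  unfolding osuc_def by (rule LeastI)

lemma osuc_le: "x < y \<Longrightarrow> osuc x \<le> y"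
  unfolding osuc_def by (rule Least_le)

lemma less_osuc_iff: "x < y \<Longrightarrow> z < osuc x \<longleftrightarrow> z \<le> x"
  by (metis less_osuc osuc_le leD leI order_le_less_trans)

lemma osuc_less_limit: "limit_ord \<alpha> \<Longrightarrow> x < \<alpha> \<Longrightarrow> osuc x < \<alpha>"
  unfolding limit_ord_def by (meson osuc_le order_le_less_trans)

lemma osup_upper: "\<forall>a\<in>A. a \<le> u \<Longrightarrow> a \<in> A \<Longrightarrow> a \<le> osup A"
  unfolding osup_def by (rule LeastI2[of _ u]) auto

lemma osup_le: "\<forall>a\<in>A. a \<le> u \<Longrightarrow> osup A \<le> u"
  unfolding osup_def by (rule Least_le)

text \<open>Lets \<open>acc\<close> and \<open>club_in\<close> be unfolded into inequalities, so
  that closure arguments can avoid \<open>osup\<close>.\<close>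

lemma limpt_iff_osup: "limpt X \<beta> \<longleftrightarrow> ozero < \<beta> \<and> osup (X \<inter> {..<\<beta>}) = \<beta>"
proof
  assume l: "limpt X \<beta>"
  have ub: "\<forall>a\<in>X \<inter> {..<\<beta>}. a \<le> \<beta>"
    by auto
  have "\<not> osup (X \<inter> {..<\<beta>}) < \<beta>"
  proof
    assume "osup (X \<inter> {..<\<beta>}) < \<beta>"
    then obtain y where "y \<in> X" "osup (X \<inter> {..<\<beta>}) < y" "y < \<beta>"
      using l unfolding limpt_def by blast
    then show False
      using osup_upper[OF ub, of y] by auto
  qed
  then show "ozero < \<beta> \<and> osup (X \<inter> {..<\<beta>}) = \<beta>"
    using l osup_le[OF ub] by (auto simp: limpt_def ozero_less_iff)
next
  assume r: "ozero < \<beta> \<and> osup (X \<inter> {..<\<beta>}) = \<beta>"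
  show "limpt X \<beta>"
    unfolding limpt_def
  proof (intro conjI allI impI)
    show "\<exists>x. x < \<beta>"
      using r by blast
    fix x assume x: "x < \<beta>"
    show "\<exists>y\<in>X. x < y \<and> y < \<beta>"
    proof (rule ccontr)
      assume "\<not> ?thesis"
      then have "\<forall>a\<in>X \<inter> {..<\<beta>}. a \<le> x"
        by (auto simp: not_less)
      from osup_le[OF this] x r show False
        by simp
    qed
  qed
qed

lemma limpt_mono: "limpt X \<beta> \<Longrightarrow> X \<subseteq> Y \<Longrightarrow> limpt Y \<beta>"
  unfolding limpt_def by blast

lemma acc_limpt: "acc C = {\<alpha>\<in>C. limpt C \<alpha>}"
  unfolding acc_def limpt_iff_osup by auto

lemma acc_ordinals: "\<alpha> \<in> acc {..<\<kappa>} \<longleftrightarrow> \<alpha> < \<kappa> \<and> limit_ord \<alpha>"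
proof -
  have "limpt {..<\<kappa>} \<alpha> \<longleftrightarrow> limit_ord \<alpha>" if "\<alpha> < \<kappa>"
    using that unfolding limpt_def limit_ord_def by (metis lessThan_iff less_trans)
  then show ?thesis
    unfolding acc_limpt by auto
qed

lemma club_in_limpt: "club_in C \<delta> \<longleftrightarrow> cofinal_in C \<delta> \<and> (\<forall>\<beta><\<delta>. limpt C \<beta> \<longrightarrow> \<beta> \<in> C)"
  unfolding club_in_def limpt_iff_osup by auto

lemma osup_cofinal:
  assumes "limit_ord \<alpha>" "cofinal_in C \<alpha>"
  shows "osup C = \<alpha>"
proof -
  have C: "C \<inter> {..<\<alpha>} = C"
    using assms(2) by (auto simp: cofinal_in_def)
  have "limpt C \<alpha>"
    using assms unfolding limpt_def limit_ord_def cofinal_in_def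
    by (metis lessThan_iff order_less_le_trans subsetD)
  then show ?thesis
    unfolding limpt_iff_osup C by simp
qed

lemma cofinal_greater:
  "limit_ord \<delta> \<Longrightarrow> cofinal_in E \<delta> \<Longrightarrow> x < \<delta> \<Longrightarrow> \<exists>e\<in>E. x < e \<and> e < \<delta>"
  unfolding limit_ord_def cofinal_in_def
  by (metis lessThan_iff order_less_le_trans subsetD)

lemma stationary_mono: "stationary_in T \<kappa> \<Longrightarrow> T \<subseteq> T' \<Longrightarrow> T' \<subseteq> {..<\<kappa>} \<Longrightarrow> stationary_in T' \<kappa>"
  unfolding stationary_in_def by blast

section \<open>Order types\<close>

lemma strict_mono_initial_ge:
  fixes f :: "'a::wellorder \<Rightarrow> 'a"
  assumes "strict_mono_on {..<\<delta>} f" "x < \<delta>"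
  shows "x \<le> f x"
  using assms(2)
proof (induction x rule: less_induct)
  case (less x)
  show ?case
  proof (rule ccontr)
    assume "\<not> x \<le> f x"
    then have lt: "f x < x"
      by simp
    then have "f x \<le> f (f x)"
      using less by auto
    moreover have "f (f x) < f x"
      using lt less.prems assms(1) unfolding strict_mono_on_def
      by (meson lessThan_iff less_trans)
    ultimately show False
      by simp
  qed
qed

text \<open>If \<epsilon> < \<delta>, the inverse of \<open>g\<close> after \<open>f\<close> would
  be a strictly increasing map of \<delta> into \<epsilon>, contradicting
  \<open>strict_mono_initial_ge\<close> at the argument \<epsilon>.\<close>

lemma enumeration_unique:
  fixes f g :: "'a::wellorder \<Rightarrow> 'a"
  assumes f: "bij_betw f {..<\<delta>} A" "strict_mono_on {..<\<delta>} f"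
    and g: "bij_betw g {..<\<epsilon>} A" "strict_mono_on {..<\<epsilon>} g"
  shows "\<delta> \<le> \<epsilon>"
proof (rule ccontr)
  assume "\<not> \<delta> \<le> \<epsilon>"
  then have lt: "\<epsilon> < \<delta>"
    by simp
  let ?h = "\<lambda>x. the_inv_into {..<\<epsilon>} g (f x)"
  have inj: "inj_on g {..<\<epsilon>}" and im: "g ` {..<\<epsilon>} = A"
    using g(1) by (auto simp: bij_betw_def)
  have fA: "f x \<in> A" if "x < \<delta>" for x
    using f(1) that by (auto simp: bij_betw_def)
  have h: "?h x < \<epsilon>" "g (?h x) = f x" if "x < \<delta>" for x
    using fA[OF that] im the_inv_into_into[OF inj, of "f x" "{..<\<epsilon>}"] f_the_inv_into_f[OF inj, of "f x"]
    by auto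
  have "strict_mono_on {..<\<delta>} ?h"
  proof (rule strict_mono_onI)
    fix x y assume xy: "x \<in> {..<\<delta>}" "y \<in> {..<\<delta>}" "x < y"
    then have "g (?h x) < g (?h y)"
      using h f(2) by (auto simp: strict_mono_on_def)
    moreover have "g (?h y) \<le> g (?h x)" if "?h y \<le> ?h x"
      using that h xy by (intro strict_mono_on_leD[OF g(2)]) auto
    ultimately show "?h x < ?h y"
      by (meson leD leI)
  qed
  from strict_mono_initial_ge[OF this lt] h(1)[OF lt] show False
    by simp
qed

lemma otp_eqI:
  fixes f :: "'a::wellorder \<Rightarrow> 'a"
  assumes "bij_betw f {..<\<delta>} A" "strict_mono_on {..<\<delta>} f"
  shows "otp A = \<delta>"
  unfolding otp_def
proof (rule the_equality)
  show "\<exists>f. bij_betw f {..<\<delta>} A \<and> strict_mono_on {..<\<delta>} f"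
    using assms by blast
next
  fix \<epsilon> :: 'a assume "\<exists>g. bij_betw g {..<\<epsilon>} A \<and> strict_mono_on {..<\<epsilon>} g"
  then show "\<epsilon> = \<delta>"
    using enumeration_unique assms by (blast intro: antisym)
qed

text \<open>\<open>p\<close> is the transitive collapse of \<open>A\<close>, extended to all
  arguments: \<open>p x\<close> is the order type of the part of \<open>A\<close> below
  \<open>x\<close>. Its inverse on \<open>A\<close> is the enumeration, and
  \<open>p \<delta>\<close> is the length.\<close>

lemma enumeration_exists:
  fixes A :: "'a::wellorder set"
  assumes "A \<subseteq> {..<\<delta>}"
  obtains f \<eta> where "\<eta> \<le> \<delta>" "bij_betw f {..<\<eta>} A" "strict_mono_on {..<\<eta>} f"
proof -
  define F where "F p x = (LEAST y. \<forall>z\<in>A. z < x \<longrightarrow> p z < y)" for p :: "'a \<Rightarrow> 'a" and x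
  define p where "p = wfrec {(x, y). x < y} F"
  have "adm_wf {(x, y). x < y} F"
    unfolding adm_wf_def F_def by (auto intro!: arg_cong[where f=Least] ext)
  then have p: "p x = (LEAST y. \<forall>z\<in>A. z < x \<longrightarrow> p z < y)" for x
    unfolding p_def by (subst wfrec_fixpoint[OF wf]) (auto simp: F_def[abs_def])
  have p_le: "p x \<le> x" for x
  proof (induction x rule: less_induct)
    case (less x)
    then show ?case
      by (subst p) (auto intro!: Least_le intro: order_le_less_trans)
  qed
  have p_less: "p z < p x" if "z \<in> A" "z < x" for z x
  proof -
    have "\<forall>z\<in>A. z < x \<longrightarrow> p z < x"
      using p_le order_le_less_trans by blast
    then have "\<forall>z\<in>A. z < x \<longrightarrow> p z < p x"
      by (subst (2) p) (rule LeastI)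
    then show ?thesis
      using that by blast
  qed
  have p_onto: "\<exists>z\<in>A. z < x \<and> p z = w" if "w < p x" for w x
    using that
  proof (induction x rule: less_induct)
    case (less x)
    from less.prems have "w < (LEAST y. \<forall>z\<in>A. z < x \<longrightarrow> p z < y)"
      by (simp only: p[of x])
    then have "\<not> (\<forall>z\<in>A. z < x \<longrightarrow> p z < w)"
      by (rule not_less_Least)
    then obtain z where z: "z \<in> A" "z < x" "w \<le> p z"
      by (auto simp: not_less)
    show ?case
    proof (cases "w = p z")
      case True
      then show ?thesis
        using z by blast
    next
      case False
      then obtain y where "y \<in> A" "y < z" "p y = w"
        using less.IH[of z] z by force
      then show ?thesis
        using z(2) less_trans by blast
    qed
  qed
  have bij: "bij_betw p A {..<p \<delta>}"
    unfolding bij_betw_def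
  proof
    show "inj_on p A"
    proof (rule inj_onI)
      fix x y assume "x \<in> A" "y \<in> A" "p x = p y"
      then show "x = y"
        using p_less[of x y] p_less[of y x] by (cases x y rule: linorder_cases) auto
    qed
    show "p ` A = {..<p \<delta>}"
    proof
      show "p ` A \<subseteq> {..<p \<delta>}"
        using p_less assms by blast
      show "{..<p \<delta>} \<subseteq> p ` A"
        using p_onto[of _ \<delta>] by blast
    qed
  qed
  let ?f = "the_inv_into A p"
  have inj: "inj_on p A"
    using bij by (auto simp: bij_betw_def)
  have bf: "bij_betw ?f {..<p \<delta>} A"
    by (rule bij_betw_the_inv_into[OF bij])
  have "strict_mono_on {..<p \<delta>} ?f"
  proof (rule strict_mono_onI)
    fix x y assume xy: "x \<in> {..<p \<delta>}" "y \<in> {..<p \<delta>}" "x < y"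
    have "?f x \<in> A" "?f y \<in> A"
      using bf xy by (auto simp: bij_betw_def)
    moreover have "p (?f x) = x" "p (?f y) = y"
      using bij xy by (auto simp: bij_betw_def intro!: f_the_inv_into_f)
    ultimately show "?f x < ?f y"
      using p_less[of "?f y" "?f x"] xy(3) by (metis less_asym linorder_neqE)
  qed
  then show thesis
    using that[OF p_le bf] by blast
qed

lemma otp_enumeration:
  assumes "A \<subseteq> {..<\<delta>}"
  obtains f where "bij_betw f {..<otp A} A" "strict_mono_on {..<otp A} f"
  using enumeration_exists[OF assms] otp_eqI by metis

lemma otp_le: "A \<subseteq> {..<\<delta>} \<Longrightarrow> otp A \<le> \<delta>"
  using enumeration_exists otp_eqI by metis

lemma onth_initial_bij:
  assumes D: "D \<subseteq> {..<\<delta>}" and k: "k < otp D"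
  obtains f where "onth D k \<in> D" "bij_betw f {..<k} (D \<inter> {..<onth D k})" "strict_mono_on {..<k} f"
proof -
  obtain f where f: "bij_betw f {..<otp D} D" "strict_mono_on {..<otp D} f"
    using otp_enumeration[OF D] .
  have init: "bij_betw f {..<j} (D \<inter> {..<f j})" "strict_mono_on {..<j} f" if j: "j < otp D" for j
  proof -
    have inj: "inj_on f {..<otp D}" and im: "f ` {..<otp D} = D"
      using f(1) by (auto simp: bij_betw_def)
    have less: "f x < f y \<longleftrightarrow> x < y" if "x < otp D" "y < otp D" for x y
      using strict_mono_on_less[OF f(2)] that by auto
    have "f ` {..<j} = D \<inter> {..<f j}"
    proof
      show "f ` {..<j} \<subseteq> D \<inter> {..<f j}"
        using im less j less_trans by blast
      show "D \<inter> {..<f j} \<subseteq> f ` {..<j}"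
      proof
        fix y assume "y \<in> D \<inter> {..<f j}"
        then have "y \<in> f ` {..<otp D}" "y < f j"
          by (simp_all add: im)
        then obtain i where "i < otp D" "y = f i" "f i < f j"
          by auto
        then show "y \<in> f ` {..<j}"
          using less j by blast
      qed
    qed
    moreover have "inj_on f {..<j}"
      using inj by (rule inj_on_subset) (use j in \<open>auto intro: less_trans\<close>)
    ultimately show "bij_betw f {..<j} (D \<inter> {..<f j})"
      by (simp add: bij_betw_def)
    show "strict_mono_on {..<j} f"
      using f(2) j unfolding strict_mono_on_def by (meson lessThan_iff less_trans)
  qed
  have "onth D k = f k"
    unfolding onth_def
  proof (rule the_equality)
    show "f k \<in> D \<and> otp (D \<inter> {..<f k}) = k"
      using init[OF k] otp_eqI f(1) k by (auto simp: bij_betw_def)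
  next
    fix x assume x: "x \<in> D \<and> otp (D \<inter> {..<x}) = k"
    then obtain j where j: "j < otp D" "x = f j"
      using f(1) by (auto simp: bij_betw_def)
    then have "otp (D \<inter> {..<x}) = j"
      using otp_eqI[OF init[OF j(1)]] by simp
    with x j show "x = f k"
      by simp
  qed
  moreover have "f k \<in> D"
    using f(1) k by (auto simp: bij_betw_def)
  ultimately show thesis
    using that init[OF k] by simp
qed

text \<open>Trades the order type in \<open>succ_set\<close> for cardinality: beside
  \<open>otp_le\<close>, later arguments know about successor elements only what is listed here. By
  \<open>j < \<sigma>\<close>, the value \<open>osuc j\<close> is a true successor.\<close>

lemma onth_osuc:
  fixes D :: "'a::wellorder set"
  assumes D: "D \<subseteq> {..<\<delta>}" and j: "j < \<sigma>" and k: "osuc j < otp D" and x: "x = onth D (osuc j)"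
  shows "x \<in> D" "\<exists>y\<in>D. y < x" "\<not> limpt D x" "|D \<inter> {..<x}| =o |{..j}|"
proof -
  have js: "{..<osuc j} = {..j}"
    using less_osuc_iff[OF j] by auto
  obtain f where f: "x \<in> D" "bij_betw f {..j} (D \<inter> {..<x})" "strict_mono_on {..j} f"
    using onth_initial_bij[OF D k] js x by metis
  show "x \<in> D" by fact
  have fj: "f j \<in> D" "f j < x"
    using f(2) by (auto simp: bij_betw_def)
  then show "\<exists>y\<in>D. y < x"
    by blast
  have "y \<le> f j" if "y \<in> D" "y < x" for y
  proof -
    obtain i where "i \<le> j" "y = f i"
      using f(2) \<open>y \<in> D\<close> \<open>y < x\<close> by (auto simp: bij_betw_def image_iff set_eq_iff)
    then show ?thesis
      using strict_mono_on_leD[OF f(3), of i j] by simp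
  qed
  then show "\<not> limpt D x"
    using fj unfolding limpt_def by (meson leD)
  show "|D \<inter> {..<x}| =o |{..j}|"
    using f(2) card_of_ordIso ordIso_symmetric by blast
qed

section \<open>Closed sets avoiding \<open>S\<close> at their limit points\<close>

text \<open>Cofinality is left out so that bounded blocks are covered as well; together with
  \<open>cofinal_in c \<delta>\<close> this describes a club in \<delta> whose accumulation points
  miss \<open>S\<close>.\<close>

definition sclosed :: "'a::wellorder set \<Rightarrow> 'a \<Rightarrow> 'a set \<Rightarrow> bool" where
  "sclosed S \<delta> c \<longleftrightarrow> c \<subseteq> {..<\<delta>} \<and> (\<forall>\<beta><\<delta>. limpt c \<beta> \<longrightarrow> \<beta> \<in> c \<and> \<beta> \<notin> S)"

lemma limpt_bounded: "limpt c \<beta> \<Longrightarrow> c \<subseteq> {..m} \<Longrightarrow> \<beta> \<le> m"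
  unfolding limpt_def by (metis atMost_iff leD leI subsetD)

lemma limpt_Int_atMost: "limpt (C \<inter> {..m}) \<beta> \<Longrightarrow> limpt C \<beta>"
  by (rule limpt_mono) auto

lemma limpt_cut: "\<beta> \<le> \<alpha> \<Longrightarrow> limpt (C \<inter> {..<\<alpha>}) \<beta> \<longleftrightarrow> limpt C \<beta>"
  unfolding limpt_def by (meson IntD1 IntI lessThan_iff order_less_le_trans)

lemma sclosed_cut:
  assumes "sclosed S \<delta> C" "m < \<delta>" "\<delta> \<le> \<kappa>"
  shows "sclosed S \<kappa> (C \<inter> {..m})"
  unfolding sclosed_def
proof (intro conjI allI impI)
  show "C \<inter> {..m} \<subseteq> {..<\<kappa>}"
    using assms by auto
  fix \<beta> assume "\<beta> < \<kappa>" and l: "limpt (C \<inter> {..m}) \<beta>"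
  have "\<beta> \<le> m"
    using limpt_bounded[OF l] by blast
  moreover have "\<beta> \<in> C \<and> \<beta> \<notin> S"
    using assms limpt_Int_atMost[OF l] \<open>\<beta> \<le> m\<close> unfolding sclosed_def by auto
  ultimately show "\<beta> \<in> C \<inter> {..m}" "\<beta> \<notin> S"
    by auto
qed

text \<open>As \<beta> is no limit point, the elements below \<beta> have an upper bound below
  \<beta>. The least such bound belongs to \<open>Z\<close>: by closure if it is a limit point, by
  minimality otherwise.\<close>

lemma sclosed_has_max:
  assumes Z: "sclosed S \<delta> Z" and b: "\<beta> \<le> \<delta>" "\<not> limpt Z \<beta>" and z: "z \<in> Z" "z < \<beta>"
  obtains m where "m \<in> Z" "m < \<beta>" "\<forall>y\<in>Z. y < \<beta> \<longrightarrow> y \<le> m"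
proof -
  let ?P = "\<lambda>x. x < \<beta> \<and> (\<forall>y\<in>Z. y < \<beta> \<longrightarrow> y \<le> x)"
  define m where "m = (LEAST x. ?P x)"
  have "\<exists>x. ?P x"
    using b z unfolding limpt_def by (meson not_less)
  then have m: "?P m"
    unfolding m_def by (rule LeastI_ex)
  have least: "m \<le> x" if "?P x" for x
    unfolding m_def using that by (rule Least_le)
  have "m \<in> Z"
  proof (cases "limpt Z m")
    case True
    then show ?thesis
      using Z m b unfolding sclosed_def by auto
  next
    case False
    show ?thesis
    proof (rule ccontr)
      assume "m \<notin> Z"
      then have "\<exists>x. x < m"
        using m z by (metis order.order_iff_strict)
      then obtain x where x: "x < m" "\<forall>y\<in>Z. y < m \<longrightarrow> y \<le> x"
        using False unfolding limpt_def by (meson not_less)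
      then have "?P x"
        using m \<open>m \<notin> Z\<close> by (metis less_trans order.order_iff_strict)
      with least x show False
        by (meson leD)
    qed
  qed
  then show thesis
    using that m by blast
qed

section \<open>Recursive thinning of closed sets and filling of their gaps\<close>

lemma set_recursion:
  fixes P :: "'a::wellorder set \<Rightarrow> 'a \<Rightarrow> bool"
  obtains Z where "\<And>\<beta>. \<beta> \<in> Z \<longleftrightarrow> P (Z \<inter> {..<\<beta>}) \<beta>"
proof -
  define F where "F q \<beta> = P ({x. q x} \<inter> {..<\<beta>}) \<beta>" for q :: "'a \<Rightarrow> bool" and \<beta>
  define q where "q = wfrec {(x, y). x < y} F"
  have adm: "adm_wf {(x, y). x < y} F"
    unfolding adm_wf_def F_def
    by (intro allI impI arg_cong2[where f=P] refl) auto
  have "q \<beta> = F q \<beta>" for \<beta>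
    unfolding q_def by (subst wfrec_fixpoint[OF wf adm]) (rule refl)
  then have "\<beta> \<in> {x. q x} \<longleftrightarrow> P ({x. q x} \<inter> {..<\<beta>}) \<beta>" for \<beta>
    unfolding mem_Collect_eq F_def .
  then show thesis
    using that by blast
qed

text \<open>The next point is \<open>nxt s\<close>, where \<open>s\<close> is the least strict upper
  bound of the points so far. Only some point of \<open>E\<close> between \<open>s\<close> and
  \<open>nxt s\<close> is required, not \<open>nxt s\<close> in \<open>E\<close>: this already makes
  every limit point of \<open>Z\<close> one of \<open>E\<close>, so that it misses \<open>S\<close>.
  The successor points are thus free to come from another set.\<close>

lemma thinning:
  fixes \<delta> :: "'a::wellorder"
  assumes lim: "limit_ord \<delta>" and E: "sclosed S \<delta> E"
    and nxt: "\<And>s. s < \<delta> \<Longrightarrow> nxt s < \<delta> \<and> (\<exists>e\<in>E. s \<le> e \<and> e \<le> nxt s)"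
  obtains Z where "cofinal_in Z \<delta>" "sclosed S \<delta> Z"
    "\<forall>\<beta>\<in>Z. \<not> limpt Z \<beta> \<longrightarrow> (\<exists>s\<le>\<beta>. \<beta> = nxt s)"
    "\<forall>z\<in>Z. \<forall>z'\<in>Z. z < z' \<longrightarrow> nxt (osuc z) \<le> z'"
proof -
  define u where "u x = (LEAST u. \<forall>y\<in>x. y < u)" for x :: "'a set"
  have u_ub: "\<forall>y\<in>x. y < u x" if "\<forall>y\<in>x. y < b" for x b
    unfolding u_def using that by (rule LeastI)
  have u_le: "u x \<le> b" if "\<forall>y\<in>x. y < b" for x b
    unfolding u_def using that by (rule Least_le)
  obtain Y where Y0: "\<And>\<beta>. \<beta> \<in> Y \<longleftrightarrow> limpt (Y \<inter> {..<\<beta>}) \<beta> \<or> \<beta> = nxt (u (Y \<inter> {..<\<beta>}))"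
    using set_recursion[of "\<lambda>x \<beta>. limpt x \<beta> \<or> \<beta> = nxt (u x)"] by metis
  have Y: "\<beta> \<in> Y \<longleftrightarrow> limpt Y \<beta> \<or> \<beta> = nxt (u (Y \<inter> {..<\<beta>}))" for \<beta>
    using Y0[of \<beta>] limpt_cut[of \<beta> \<beta> Y] by blast
  have cof: "\<exists>y\<in>Y. b \<le> y \<and> y < \<delta>" if b: "b < \<delta>" for b
  proof (rule ccontr)
    assume no: "\<not> ?thesis"
    let ?s = "u (Y \<inter> {..<\<delta>})"
    have "\<forall>y\<in>Y \<inter> {..<\<delta>}. y < b"
      using no by (auto simp: not_le)
    then have s: "?s \<le> b" "\<forall>y\<in>Y \<inter> {..<\<delta>}. y < ?s"
      using u_le u_ub by blast+
    then have "?s < \<delta>"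
      using b by simp
    with nxt obtain e where n: "nxt ?s < \<delta>" "?s \<le> e" "e \<le> nxt ?s"
      by blast
    then have le: "?s \<le> nxt ?s"
      by simp
    \<comment> \<open>If \<open>Y\<close> stopped before \<open>?s\<close>, the clause at
      \<open>nxt ?s\<close> would see the same initial part and add \<open>nxt ?s\<close>.\<close>
    have "Y \<inter> {..<nxt ?s} = Y \<inter> {..<\<delta>}"
      using s(2) le n(1) by (auto intro: order_less_le_trans)
    then have "nxt ?s = nxt (u (Y \<inter> {..<nxt ?s}))"
      by (simp only:)
    then have "nxt ?s \<in> Y"
      using Y by blast
    then show False
      using s(2) n(1) le by (meson IntI leD lessThan_iff)
  qed
  have step: "\<exists>z'\<in>Y. z < z' \<and> z' \<le> w \<and> z' = nxt (osuc z) \<and> (\<exists>e\<in>E. z < e \<and> e \<le> z')"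
    if z: "z \<in> Y" "w \<in> Y" "z < w" "w < \<delta>" for z w
  proof -
    \<comment> \<open>The next element of \<open>Y\<close> after \<open>z\<close>. It is no limit
      point, so it arose from \<open>nxt\<close>, applied to the least strict upper bound
      \<open>osuc z\<close>.\<close>
    define z' where "z' = (LEAST x. x \<in> Y \<and> z < x)"
    have z': "z' \<in> Y" "z < z'" "z' \<le> w"
      using LeastI[of "\<lambda>x. x \<in> Y \<and> z < x" w] Least_le[of "\<lambda>x. x \<in> Y \<and> z < x" w] z
      unfolding z'_def by auto
    have least: "y \<le> z" if "y \<in> Y" "y < z'" for y
      using that not_less_Least[of y "\<lambda>x. x \<in> Y \<and> z < x"] unfolding z'_def by auto
    have "\<not> limpt Y z'"
      using least z'(2) unfolding limpt_def by (meson leD)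
    then have eq: "z' = nxt (u (Y \<inter> {..<z'}))"
      using Y z'(1) by blast
    have ub: "\<forall>y\<in>Y \<inter> {..<z'}. y < osuc z"
      using least less_osuc_iff[OF z'(2)] by auto
    have "u (Y \<inter> {..<z'}) = osuc z"
    proof (rule antisym)
      show "u (Y \<inter> {..<z'}) \<le> osuc z"
        using u_le[OF ub] .
      show "osuc z \<le> u (Y \<inter> {..<z'})"
        using u_ub[OF ub] z(1) z'(2) by (intro osuc_le) auto
    qed
    with eq have eq: "z' = nxt (osuc z)"
      by simp
    have "osuc z < \<delta>"
      using osuc_less_limit[OF lim] z by simp
    then obtain e where "e \<in> E" "osuc z \<le> e" "e \<le> nxt (osuc z)"
      using nxt by blast
    then show ?thesis
      using z' eq less_osuc[OF z'(2)] by (metis order_less_le_trans)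
  qed
  \<comment> \<open>The recursion runs through the whole type, but \<open>nxt\<close> is controlled
    only below \<delta>.\<close>
  let ?Z = "Y \<inter> {..<\<delta>}"
  have limZ: "limpt ?Z \<beta> \<longleftrightarrow> limpt Y \<beta>" if "\<beta> < \<delta>" for \<beta>
    using limpt_cut[of \<beta> \<delta> Y] that by simp
  show thesis
  proof (rule that[of ?Z])
    show "cofinal_in ?Z \<delta>"
      unfolding cofinal_in_def using cof by auto
    show "sclosed S \<delta> ?Z"
      unfolding sclosed_def
    proof (intro conjI allI impI)
      fix \<beta> assume b: "\<beta> < \<delta>" and "limpt ?Z \<beta>"
      then have l: "limpt Y \<beta>"
        using limZ by simp
      then show "\<beta> \<in> ?Z"
        using Y b by blast
      have "limpt E \<beta>"
        unfolding limpt_def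
      proof (intro conjI allI impI)
        show "\<exists>x. x < \<beta>"
          using l by (auto simp: limpt_def)
        fix x assume "x < \<beta>"
        then obtain z where z: "z \<in> Y" "x < z" "z < \<beta>"
          using l unfolding limpt_def by blast
        then obtain w where w: "w \<in> Y" "z < w" "w < \<beta>"
          using l unfolding limpt_def by blast
        obtain e where "e \<in> E" "z < e" "e \<le> w"
          using step[OF z(1) w(1,2)] w(3) b by (meson order_trans less_trans)
        then show "\<exists>y\<in>E. x < y \<and> y < \<beta>"
          using z w by (meson less_trans order_le_less_trans)
      qed
      then show "\<beta> \<notin> S"
        using E b unfolding sclosed_def by blast
    qed auto
    show "\<forall>\<beta>\<in>?Z. \<not> limpt ?Z \<beta> \<longrightarrow> (\<exists>s\<le>\<beta>. \<beta> = nxt s)"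
    proof (intro ballI impI)
      fix \<beta> assume "\<beta> \<in> ?Z" "\<not> limpt ?Z \<beta>"
      then have "\<beta> = nxt (u (Y \<inter> {..<\<beta>}))"
        using Y[of \<beta>] limZ[of \<beta>] by auto
      moreover have "u (Y \<inter> {..<\<beta>}) \<le> \<beta>"
        by (rule u_le) auto
      ultimately show "\<exists>s\<le>\<beta>. \<beta> = nxt s"
        by blast
    qed
    show "\<forall>z\<in>?Z. \<forall>z'\<in>?Z. z < z' \<longrightarrow> nxt (osuc z) \<le> z'"
      using step by auto
  qed
qed

text \<open>Between \<open>z\<close> and the next point of \<open>Z\<close> only the block
  \<open>d z\<close> is present. So a limit point of \<open>C\<close> is one of \<open>Z\<close>, or
  one of the block above the last point of \<open>Z\<close> before it. The third conclusion lets
  properties of a block on an interval be read off in \<open>C\<close>.\<close>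

lemma filling:
  fixes \<delta> :: "'a::wellorder"
  assumes Z: "cofinal_in Z \<delta>" "sclosed S \<delta> Z"
    and blocks: "\<forall>z\<in>Z. sclosed S \<delta> (d z) \<and> d z \<subseteq> {z<..}"
    and separated: "\<forall>z\<in>Z. \<forall>z'\<in>Z. z < z' \<longrightarrow> d z \<subseteq> {..<z'}"
    and C: "C = Z \<union> (\<Union>z\<in>Z. d z)"
  shows "cofinal_in C \<delta>" "sclosed S \<delta> C"
    "\<And>z \<gamma> \<gamma>'. z \<in> Z \<Longrightarrow> \<gamma> \<in> d z \<Longrightarrow> \<gamma>' \<in> d z \<Longrightarrow> C \<inter> {\<gamma>..\<gamma>'} = d z \<inter> {\<gamma>..\<gamma>'}"
proof -
  have d: "sclosed S \<delta> (d z)" "d z \<subseteq> {z<..}" if "z \<in> Z" for z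
    using blocks that by blast+
  have sep: "d z \<subseteq> {..<z'}" if "z \<in> Z" "z' \<in> Z" "z < z'" for z z'
    using separated that by blast
  have sub: "C \<subseteq> {..<\<delta>}"
    using Z d(1) unfolding C sclosed_def by auto
  then show "cofinal_in C \<delta>"
    using Z(1) unfolding cofinal_in_def C by blast
  have local: "y \<in> d z" if hyp: "z \<in> Z" "y \<in> C" "z < y" "\<forall>w\<in>Z. z < w \<longrightarrow> y < w" for z y
  proof -
    have "y \<notin> Z"
      using hyp by blast
    then obtain w where w: "w \<in> Z" "y \<in> d w"
      using hyp(2) unfolding C by blast
    have "w < y"
      using d(2) w by blast
    then have "\<not> z < w"
      using hyp(4) w(1) by (meson less_asym)
    moreover have "\<not> w < z"
      using sep[OF w(1) hyp(1)] w(2) hyp(3) by (meson lessThan_iff less_asym subsetD)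
    ultimately show ?thesis
      using w by (metis linorder_neqE)
  qed
  show "C \<inter> {\<gamma>..\<gamma>'} = d z \<inter> {\<gamma>..\<gamma>'}" if z: "z \<in> Z" "\<gamma> \<in> d z" "\<gamma>' \<in> d z" for z \<gamma> \<gamma>'
  proof
    show "d z \<inter> {\<gamma>..\<gamma>'} \<subseteq> C \<inter> {\<gamma>..\<gamma>'}"
      using z unfolding C by blast
    show "C \<inter> {\<gamma>..\<gamma>'} \<subseteq> d z \<inter> {\<gamma>..\<gamma>'}"
    proof
      fix y assume y: "y \<in> C \<inter> {\<gamma>..\<gamma>'}"
      have "z < y"
        using d(2)[OF z(1)] z(2) y by (auto intro: order_less_le_trans)
      moreover have "\<forall>w\<in>Z. z < w \<longrightarrow> y < w"
        using sep[OF z(1)] z(3) y by (auto intro: order_le_less_trans)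
      ultimately show "y \<in> d z \<inter> {\<gamma>..\<gamma>'}"
        using local[OF z(1)] y by blast
    qed
  qed
  show "sclosed S \<delta> C"
    unfolding sclosed_def
  proof (intro conjI[OF sub] allI impI)
    fix \<beta> assume b: "\<beta> < \<delta>" and l: "limpt C \<beta>"
    show "\<beta> \<in> C \<and> \<beta> \<notin> S"
    proof (cases "limpt Z \<beta>")
      case True
      then show ?thesis
        using Z(2) b unfolding sclosed_def C by blast
    next
      case False
      obtain y where y: "y \<in> C" "y < \<beta>"
        using l unfolding limpt_def by blast
      then have "\<exists>z\<in>Z. z < \<beta>"
        using d(2) unfolding C by (auto intro: less_trans)
      then obtain z where z: "z \<in> Z" "z < \<beta>" "\<forall>y\<in>Z. y < \<beta> \<longrightarrow> y \<le> z"
        using sclosed_has_max[OF Z(2) _ False] b by (metis less_imp_le)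
      have "limpt (d z) \<beta>"
        unfolding limpt_def
      proof (intro conjI allI impI)
        show "\<exists>x. x < \<beta>"
          using y by blast
        fix x assume x: "x < \<beta>"
        obtain y where y: "y \<in> C" "max x z < y" "y < \<beta>"
          using l x z(2) unfolding limpt_def by (metis max_less_iff_conj)
        have "\<forall>w\<in>Z. z < w \<longrightarrow> y < w"
          using z(3) y(3) by (meson leD leI order_less_le_trans)
        then have "y \<in> d z"
          using local[OF z(1) y(1)] y(2) by simp
        then show "\<exists>y\<in>d z. x < y \<and> y < \<beta>"
          using y by auto
      qed
      then show ?thesis
        using d(1)[OF z(1)] b z(1) unfolding sclosed_def C by blast
    qed
  qed
qed

text \<open>The running maxima of an enumeration of \<open>A\<close> take only finitely many values
  below any \<beta> < \<alpha>. Their range has no limit point below \<alpha>, so \<open>S\<close>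
  is avoided vacuously.\<close>

lemma countably_cofinal_avoiding:
  fixes \<alpha> :: "'a::wellorder"
  assumes lim: "limit_ord \<alpha>" and A: "cofinal_in A \<alpha>" "countable A"
  obtains E where "cofinal_in E \<alpha>" "sclosed S \<alpha> E"
proof -
  have "A \<noteq> {}"
    using lim A(1) unfolding limit_ord_def cofinal_in_def by blast
  then have r: "range (from_nat_into A) = A"
    using A(2) by (rule range_from_nat_into)
  define b where "b n = Max (from_nat_into A ` {..n})" for n :: nat
  have bA: "b n \<in> A" for n
    unfolding b_def using r Max_in[of "from_nat_into A ` {..n}"] by blast
  have b_ge: "from_nat_into A k \<le> b n" if "k \<le> n" for k n
    unfolding b_def using that by (intro Max_ge) auto
  have cof: "\<exists>k. \<beta> \<le> from_nat_into A k" if "\<beta> < \<alpha>" for \<beta>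
    using A(1) that r unfolding cofinal_in_def by (metis rangeE)
  have cofb: "cofinal_in (range b) \<alpha>"
    unfolding cofinal_in_def
  proof (intro conjI allI impI)
    show "range b \<subseteq> {..<\<alpha>}"
      using bA A(1) unfolding cofinal_in_def by blast
    fix \<beta> assume "\<beta> < \<alpha>"
    then show "\<exists>a\<in>range b. \<beta> \<le> a"
      using cof b_ge by (meson order_trans order_refl rangeI)
  qed
  have "\<not> limpt (range b) \<beta>" if \<beta>: "\<beta> < \<alpha>" for \<beta>
  proof
    assume l: "limpt (range b) \<beta>"
    obtain k where k: "\<beta> \<le> from_nat_into A k"
      using cof[OF \<beta>] by blast
    let ?X = "range b \<inter> {..<\<beta>}"
    have "?X \<subseteq> b ` {..<k}"
    proof
      fix y assume "y \<in> ?X"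
      then obtain n where "y = b n" "b n < \<beta>"
        by blast
      then show "y \<in> b ` {..<k}"
        using b_ge[of k n] k by (cases "k \<le> n") auto
    qed
    then have fin: "finite ?X"
      by (rule finite_subset) simp
    have "?X \<noteq> {}"
      using l unfolding limpt_def by blast
    then have "Max ?X < \<beta>"
      using Max_in[OF fin] by blast
    then obtain y where "y \<in> ?X" "Max ?X < y"
      using l unfolding limpt_def by blast
    then show False
      using Max_ge[OF fin] by (meson leD)
  qed
  then have "sclosed S \<alpha> (range b)"
    using cofb unfolding sclosed_def cofinal_in_def by auto
  with cofb show thesis
    by (rule that)
qed

text \<open>Nonreflection speaks only about uncountable cofinality, where it yields a club disjoint
  from \<open>S\<close>. In countable cofinality a cofinal set without limit points takes its
  place.\<close>

lemma nonreflecting_avoiding: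
  fixes \<alpha> \<kappa> :: "'a::wellorder"
  assumes nr: "nonreflecting \<kappa> S" and a: "\<alpha> < \<kappa>" "limit_ord \<alpha>"
  obtains E where "cofinal_in E \<alpha>" "sclosed S \<alpha> E"
proof (cases "uncountable {..<cof \<alpha>}")
  case True
  then have "\<not> stationary_in (S \<inter> {..<\<alpha>}) \<alpha>"
    using nr a unfolding nonreflecting_def by blast
  then obtain C where "club_in C \<alpha>" "S \<inter> {..<\<alpha>} \<inter> C = {}"
    unfolding stationary_in_def by blast
  then have "cofinal_in C \<alpha>" "sclosed S \<alpha> C"
    unfolding club_in_limpt sclosed_def cofinal_in_def by blast+
  then show thesis
    by (rule that)
next
  case False
  have "\<exists>A. cofinal_in A \<alpha> \<and> otp A = cof \<alpha>"
    unfolding cof_def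
  proof (rule LeastI)
    show "\<exists>A. cofinal_in A \<alpha> \<and> otp A = otp {..<\<alpha>}"
      by (intro exI[of _ "{..<\<alpha>}"]) (auto simp: cofinal_in_def)
  qed
  then obtain A where A: "cofinal_in A \<alpha>" "otp A = cof \<alpha>"
    by blast
  then obtain f where "bij_betw f {..<cof \<alpha>} A"
    using otp_enumeration[of A \<alpha>] unfolding cofinal_in_def by metis
  then have "countable A"
    using False countable_image[of "{..<cof \<alpha>}" f] by (auto simp: bij_betw_def)
  then show thesis
    using countably_cofinal_avoiding[OF a(2) A(1)] that by blast
qed

section \<open>Strongly inaccessible cardinals\<close>

locale inaccessible =
  fixes \<kappa> :: "'a::wellorder"
  assumes inacc: "strongly_inaccessible \<kappa>"
begin

lemma Field_ord_rel: "Field (ord_rel \<kappa>) = {..<\<kappa>}"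
  unfolding ord_rel_def Field_def by force

lemma card_ord_rel: "|{..<\<kappa>}| =o ord_rel \<kappa>"
  using card_of_Field_ordIso[of "ord_rel \<kappa>"] inacc
  unfolding strongly_inaccessible_def Field_ord_rel by blast

lemma less_ord_rel_iff: "|A| <o ord_rel \<kappa> \<longleftrightarrow> |A| <o |{..<\<kappa>}|"
  using card_ord_rel ordIso_symmetric ordLess_ordIso_trans by blast

lemma uncountable_kappa: "uncountable {..<\<kappa>}"
  using inacc unfolding strongly_inaccessible_def by blast

lemma infinite_kappa: "infinite {..<\<kappa>}"
  using uncountable_kappa countable_finite by blast

lemma limit_kappa: "limit_ord \<kappa>"
proof -
  have "\<exists>y\<in>{..<\<kappa>}. x \<noteq> y \<and> (x, y) \<in> ord_rel \<kappa>" if "x < \<kappa>" for x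
    using infinite_Card_order_limit[of "ord_rel \<kappa>" x] infinite_kappa inacc that
    unfolding strongly_inaccessible_def Field_ord_rel by auto
  then have "\<exists>y<\<kappa>. x < y" if "x < \<kappa>" for x
    using that unfolding ord_rel_def by fastforce
  moreover have "\<exists>x. x < \<kappa>"
    using infinite_imp_nonempty[OF infinite_kappa] by blast
  ultimately show ?thesis
    unfolding limit_ord_def by blast
qed

lemma small_bounded:
  assumes "A \<subseteq> {..<\<kappa>}" "|A| <o |{..<\<kappa>}|"
  obtains b where "b < \<kappa>" "\<forall>a\<in>A. a < b"
proof (rule ccontr)
  assume "\<not> thesis"
  then have no: "\<exists>a\<in>A. b \<le> a" if "b < \<kappa>" for b
    using that \<open>\<And>b. b < \<kappa> \<Longrightarrow> \<forall>a\<in>A. a < b \<Longrightarrow> thesis\<close> by (meson not_le)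
  have "cofinal A (ord_rel \<kappa>)"
    unfolding cofinal_def Field_ord_rel
  proof
    fix x assume "x \<in> {..<\<kappa>}"
    then obtain y where y: "y < \<kappa>" "x < y"
      using limit_kappa unfolding limit_ord_def by blast
    then obtain a where "a \<in> A" "y \<le> a"
      using no by blast
    then show "\<exists>b\<in>A. x \<noteq> b \<and> (x, b) \<in> ord_rel \<kappa>"
      using assms(1) y unfolding ord_rel_def by (intro bexI[of _ a]) auto
  qed
  then have "|A| =o ord_rel \<kappa>"
    using inacc assms(1) unfolding strongly_inaccessible_def regularCard_def Field_ord_rel by blast
  then show False
    using assms(2) less_ord_rel_iff not_ordLess_ordIso by blast
qed

lemma image_bounded:
  assumes "|I| <o |{..<\<kappa>}|" "\<And>i. i \<in> I \<Longrightarrow> f i < \<kappa>"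
  obtains b where "b < \<kappa>" "\<forall>i\<in>I. f i < b"
proof -
  have "|f ` I| <o |{..<\<kappa>}|"
    using card_of_image assms(1) by (rule ordLeq_ordLess_trans)
  moreover have "f ` I \<subseteq> {..<\<kappa>}"
    using assms(2) by blast
  ultimately obtain b where "b < \<kappa>" "\<forall>a\<in>f ` I. a < b"
    using small_bounded by metis
  then show thesis
    by (intro that[of b]) auto
qed

lemma small_Pow: "\<mu> < \<kappa> \<Longrightarrow> |Pow {..<\<mu>}| <o |{..<\<kappa>}|"
  using inacc less_ord_rel_iff unfolding strongly_inaccessible_def by blast

lemma small_lessThan: "\<mu> < \<kappa> \<Longrightarrow> |{..<\<mu>}| <o |{..<\<kappa>}|"
  using small_Pow card_of_Pow ordLess_transitive by blast

lemma atMost_eq: "\<mu> < \<kappa> \<Longrightarrow> {..\<mu>} = {..<osuc \<mu>}"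
  using less_osuc_iff by auto

lemma osuc_less: "\<mu> < \<kappa> \<Longrightarrow> osuc \<mu> < \<kappa>"
  using osuc_less_limit[OF limit_kappa] .

lemma small_atMost: "\<mu> < \<kappa> \<Longrightarrow> |{..\<mu>}| <o |{..<\<kappa>}|"
  using small_lessThan osuc_less by (simp add: atMost_eq)

lemma small_nat: "|UNIV :: nat set| <o |{..<\<kappa>}|"
proof -
  have "\<not> |{..<\<kappa>}| \<le>o |UNIV :: nat set|"
    using uncountable_kappa card_of_ordLeq[of "{..<\<kappa>}" "UNIV :: nat set"] unfolding countable_def by blast
  then show ?thesis
    using not_ordLeq_iff_ordLess[OF card_of_Well_order card_of_Well_order] by blast
qed

text \<open>\<alpha> is the supremum of the iterates of a function \<open>h\<close> dominating
  \<open>g\<close>. It lies below \<kappa> because \<kappa> is regular and uncountable.\<close>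

lemma closure_point:
  assumes g: "\<And>x. x < \<kappa> \<Longrightarrow> g x < \<kappa>" and b: "\<beta> < \<kappa>"
  obtains \<alpha> where "\<alpha> < \<kappa>" "\<beta> < \<alpha>" "\<forall>x<\<alpha>. g x < \<alpha>"
proof -
  have "\<exists>z<\<kappa>. y < z \<and> (\<forall>x\<le>y. g x < z)" if y: "y < \<kappa>" for y
  proof -
    obtain z where "z < \<kappa>" "\<forall>x\<in>{..y}. g x < z"
      using image_bounded[OF small_atMost[OF y], of g] g y by (metis atMost_iff order_le_less_trans)
    then show ?thesis
      using osuc_less[OF y] less_osuc[OF y]
      by (intro exI[of _ "max z (osuc y)"]) (auto simp: less_max_iff_disj)
  qed
  then obtain h where h: "\<And>y. y < \<kappa> \<Longrightarrow> h y < \<kappa> \<and> y < h y \<and> (\<forall>x\<le>y. g x < h y)"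
    by metis
  define s where "s n = (h ^^ n) \<beta>" for n
  have s_less: "s n < \<kappa>" for n
    by (induction n) (use b h in \<open>auto simp: s_def\<close>)
  have s_Suc: "s (Suc n) = h (s n)" for n
    by (simp add: s_def)
  obtain u where u: "u < \<kappa>" "\<forall>n. s n < u"
    using image_bounded[OF small_nat, of s] s_less by auto
  define \<alpha> where "\<alpha> = (LEAST u. \<forall>n. s n < u)"
  have a: "\<forall>n. s n < \<alpha>" "\<alpha> \<le> u"
    unfolding \<alpha>_def using u(2) by (rule LeastI, rule Least_le)
  have "g x < \<alpha>" if x: "x < \<alpha>" for x
  proof -
    obtain n where "x \<le> s n"
      using x not_less_Least[of x "\<lambda>u. \<forall>n. s n < u"] unfolding \<alpha>_def by (auto simp: not_less)
    then have "g x < s (Suc n)"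
      using h[OF s_less] s_Suc by simp
    then show ?thesis
      using a(1) less_trans by blast
  qed
  moreover have "\<beta> < \<alpha>"
    using a(1)[rule_format, of 0] by (simp add: s_def)
  ultimately show thesis
    using that a(2) u(1) by (meson order_le_less_trans)
qed

text \<open>A given club \<open>C\<close> is absorbed by combining \<open>g\<close> with a function
  \<open>n\<close> that moves to a larger element of \<open>C\<close>: a closure point of both is a
  limit point of \<open>C\<close> and hence in \<open>C\<close>.\<close>

lemma stationary_closure:
  assumes T: "stationary_in T \<kappa>" and g: "\<And>x. x < \<kappa> \<Longrightarrow> g x < \<kappa>"
  shows "stationary_in {\<alpha>\<in>T. limit_ord \<alpha> \<and> (\<forall>x<\<alpha>. g x < \<alpha>)} \<kappa>"
  unfolding stationary_in_def
proof (intro conjI allI impI)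
  show "{\<alpha>\<in>T. limit_ord \<alpha> \<and> (\<forall>x<\<alpha>. g x < \<alpha>)} \<subseteq> {..<\<kappa>}"
    using T unfolding stationary_in_def by blast
  fix C assume C: "club_in C \<kappa>"
  then have "cofinal_in C \<kappa>"
    unfolding club_in_def by blast
  then obtain n where n: "\<And>x. x < \<kappa> \<Longrightarrow> n x \<in> C \<and> x < n x \<and> n x < \<kappa>"
    using cofinal_greater[OF limit_kappa] by metis
  let ?g = "\<lambda>x. max (g x) (n x)"
  define D where "D = {\<alpha>. \<alpha> < \<kappa> \<and> ozero < \<alpha> \<and> (\<forall>x<\<alpha>. ?g x < \<alpha>)}"
  have "club_in D \<kappa>"
    unfolding club_in_limpt cofinal_in_def
  proof (intro conjI allI impI)
    show "D \<subseteq> {..<\<kappa>}"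
      by (auto simp: D_def)
    fix \<beta> assume b: "\<beta> < \<kappa>"
    have "\<And>x. x < \<kappa> \<Longrightarrow> ?g x < \<kappa>"
      using g n by simp
    then obtain \<alpha> where "\<alpha> < \<kappa>" "\<beta> < \<alpha>" "\<forall>x<\<alpha>. ?g x < \<alpha>"
      using closure_point[of ?g, OF _ b] by blast
    then show "\<exists>a\<in>D. \<beta> \<le> a"
      using order_le_less_trans[OF ozero_le] unfolding D_def by (intro bexI[of _ \<alpha>]) auto
    show "\<beta> \<in> D" if "limpt D \<beta>"
      using that b unfolding limpt_def D_def ozero_less_iff by (auto intro: less_trans)
  qed
  then obtain \<alpha> where a: "\<alpha> \<in> T" "\<alpha> < \<kappa>" "ozero < \<alpha>" "\<forall>x<\<alpha>. ?g x < \<alpha>"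
    using T unfolding stationary_in_def D_def by blast
  have n': "n x \<in> C \<and> x < n x \<and> n x < \<alpha>" if "x < \<alpha>" for x
    using n[of x] a(2,4) that by auto
  then have "limpt C \<alpha>" "limit_ord \<alpha>"
    using a(3) unfolding limpt_def limit_ord_def by blast+
  moreover have "\<alpha> \<in> C"
    using C \<open>limpt C \<alpha>\<close> a(2) unfolding club_in_limpt by blast
  ultimately show "{\<alpha>\<in>T. limit_ord \<alpha> \<and> (\<forall>x<\<alpha>. g x < \<alpha>)} \<inter> C \<noteq> {}"
    using a by auto
qed

text \<open>\<delta> is the least ordinal with more than |\<mu>| many points of \<open>G\<close>
  below it. An unbounded subset of \<delta> of size at most |\<mu>| would cover that part of
  \<open>G\<close> by |\<mu>| many sets of size at most |\<mu>|. Counting thus gives cofinality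
  above |\<mu>|.\<close>

lemma large_cofinality_closure_point:
  assumes mu: "\<mu> < \<kappa>" "infinite {..<\<mu>}" and xi: "\<xi> < \<kappa>" and g: "\<And>x. x < \<kappa> \<Longrightarrow> g x < \<kappa>"
  obtains \<delta> where "\<delta> < \<kappa>" "\<xi> < \<delta>" "limit_ord \<delta>" "\<forall>x<\<delta>. g x < \<delta>"
    "\<And>A. A \<subseteq> {..<\<delta>} \<Longrightarrow> |A| \<le>o |{..<\<mu>}| \<Longrightarrow> \<exists>b<\<delta>. \<forall>a\<in>A. a < b"
proof -
  define G where "G = {\<alpha>. \<alpha> < \<kappa> \<and> \<xi> < \<alpha> \<and> (\<forall>x<\<alpha>. g x < \<alpha>)}"
  have "\<not> |G| <o |{..<\<kappa>}|"
  proof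
    assume "|G| <o |{..<\<kappa>}|"
    then obtain b where b: "b < \<kappa>" "\<forall>a\<in>G. a < b"
      using small_bounded[of G] unfolding G_def by blast
    then obtain \<alpha> where "\<alpha> < \<kappa>" "max b \<xi> < \<alpha>" "\<forall>x<\<alpha>. g x < \<alpha>"
      using closure_point[of g "max b \<xi>"] g xi by auto
    then have "\<alpha> \<in> G" "b < \<alpha>"
      unfolding G_def by auto
    then show False
      using b(2) by (meson less_asym)
  qed
  then have "|{..<\<kappa>}| \<le>o |G|"
    using not_ordLess_iff_ordLeq[OF card_of_Well_order card_of_Well_order] by blast
  \<comment> \<open>The power set serves as a set larger than \<mu> and still smaller than \<kappa>;
    its image in \<open>G\<close> is bounded by some \<open>b\<close>, below which \<open>G\<close>
    then has enough points.\<close>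
  then have "|Pow {..<\<mu>}| \<le>o |G|"
    using small_Pow[OF mu(1)] ordLess_imp_ordLeq ordLeq_transitive by blast
  then obtain f where f: "inj_on f (Pow {..<\<mu>})" "f ` Pow {..<\<mu>} \<subseteq> G"
    using card_of_ordLeq[of "Pow {..<\<mu>}" G] by blast
  obtain b where b: "b < \<kappa>" "\<forall>i\<in>Pow {..<\<mu>}. f i < b"
    using image_bounded[OF small_Pow[OF mu(1)], of f] f(2) unfolding G_def by blast
  let ?P = "\<lambda>\<delta>. \<not> |G \<inter> {..<\<delta>}| \<le>o |{..<\<mu>}|"
  have "|Pow {..<\<mu>}| \<le>o |G \<inter> {..<b}|"
    using f b card_of_ordLeq[of "Pow {..<\<mu>}" "G \<inter> {..<b}"] by blast
  then have Pb: "?P b"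
    using card_of_Pow[of "{..<\<mu>}"] not_ordLess_ordLeq ordLeq_transitive by blast
  define \<delta> where "\<delta> = (LEAST \<delta>. ?P \<delta>)"
  have P: "?P \<delta>" and le: "\<delta> \<le> b"
    unfolding \<delta>_def using Pb by (rule LeastI, rule Least_le)
  have below: "|G \<inter> {..<x}| \<le>o |{..<\<mu>}|" if "x < \<delta>" for x
    using that not_less_Least unfolding \<delta>_def by blast
  have Un: "|X \<union> Y| \<le>o |{..<\<mu>}|" if "|X| \<le>o |{..<\<mu>}|" "|Y| \<le>o |{..<\<mu>}|" for X Y :: "'a set"
    using card_of_Un_ordLeq_infinite_Field[of "|{..<\<mu>}|" X Y] mu(2) that
    by (simp add: Field_card_of card_of_card_order_on)
  have bounded: "\<exists>b<\<delta>. \<forall>a\<in>A. a < b" if A: "A \<subseteq> {..<\<delta>}" "|A| \<le>o |{..<\<mu>}|" for A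
  proof (rule ccontr)
    assume "\<not> ?thesis"
    then have unb: "\<exists>a\<in>A. b \<le> a" if "b < \<delta>" for b
      using that by (meson not_le)
    have "G \<inter> {..<\<delta>} \<subseteq> (\<Union>a\<in>A. G \<inter> {..<a}) \<union> A"
    proof
      fix x assume x: "x \<in> G \<inter> {..<\<delta>}"
      then obtain a where "a \<in> A" "x \<le> a"
        using unb by blast
      then show "x \<in> (\<Union>a\<in>A. G \<inter> {..<a}) \<union> A"
        using x by (cases "x = a") (auto intro!: bexI[of _ a])
    qed
    moreover have "|(\<Union>a\<in>A. G \<inter> {..<a}) \<union> A| \<le>o |{..<\<mu>}|"
      using A below by (intro Un card_of_UNION_ordLeq_infinite mu(2)) auto
    ultimately show False
      using P card_of_mono1 ordLeq_transitive by blast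
  qed
  \<comment> \<open>Otherwise \<open>G\<close> below \<delta> is its part below \<open>x\<close>
    plus at most one point, hence of size at most |\<mu>|, against the choice of \<delta>.\<close>
  have unbounded: "\<exists>y\<in>G. x < y \<and> y < \<delta>" if x: "x < \<delta>" for x
  proof (rule ccontr)
    assume "\<not> ?thesis"
    then have "G \<inter> {..<\<delta>} \<subseteq> (G \<inter> {..<x}) \<union> {x}"
      by (auto simp: order.order_iff_strict not_less)
    moreover have "|{x}| \<le>o |{..<\<mu>}|"
      by (rule card_of_singl_ordLeq) (use mu(2) in auto)
    then have "|(G \<inter> {..<x}) \<union> {x}| \<le>o |{..<\<mu>}|"
      using below[OF x] Un by blast
    ultimately show False
      using P card_of_mono1 ordLeq_transitive by blast
  qed
  have "G \<inter> {..<\<delta>} \<noteq> {}"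
    using P card_of_empty by fastforce
  then have "\<xi> < \<delta>"
    unfolding G_def by (auto intro: less_trans)
  have lim: "limit_ord \<delta>"
    using unbounded \<open>\<xi> < \<delta>\<close> unfolding limit_ord_def by blast
  have closed: "\<forall>x<\<delta>. g x < \<delta>"
  proof (intro allI impI)
    fix x assume "x < \<delta>"
    then obtain y where "y \<in> G" "x < y" "y < \<delta>"
      using unbounded by blast
    then show "g x < \<delta>"
      unfolding G_def by (auto intro: less_trans)
  qed
  have "\<delta> < \<kappa>"
    using le b(1) by simp
  then show thesis
    using \<open>\<xi> < \<delta>\<close> lim closed bounded by (rule that)
qed

text \<open>The power set embeds below some \<open>b\<close>, the natural numbers below some
  \<open>b'\<close>, and the maximum accommodates both. The power set is taken because blocks have
  to be strictly larger than \<open>{..\<xi>}\<close>.\<close>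

lemma exists_larger:
  assumes "\<xi> < \<kappa>"
  obtains \<mu> where "\<mu> < \<kappa>" "infinite {..<\<mu>}" "|Pow {..\<xi>}| \<le>o |{..<\<mu>}|"
proof -
  have P: "|Pow {..\<xi>}| <o |{..<\<kappa>}|"
    using small_Pow[OF osuc_less[OF assms]] atMost_eq[OF assms] by simp
  then obtain f where f: "inj_on f (Pow {..\<xi>})" "f ` Pow {..\<xi>} \<subseteq> {..<\<kappa>}"
    using card_of_ordLeq[of "Pow {..\<xi>}" "{..<\<kappa>}"] ordLess_imp_ordLeq by blast
  obtain b where b: "b < \<kappa>" "\<forall>i\<in>Pow {..\<xi>}. f i < b"
    using image_bounded[OF P, of f] f(2) by blast
  obtain h :: "nat \<Rightarrow> 'a" where h: "inj h" "range h \<subseteq> {..<\<kappa>}"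
    using card_of_ordLeq[of "UNIV :: nat set" "{..<\<kappa>}"] small_nat ordLess_imp_ordLeq by blast
  obtain b' where b': "b' < \<kappa>" "\<forall>i. h i < b'"
    using image_bounded[OF small_nat, of h] h(2) by (auto simp: image_subset_iff)
  have "range h \<subseteq> {..<max b b'}"
    using b'(2) by (auto simp: less_max_iff_disj)
  then have "infinite {..<max b b'}"
    using h(1) infinite_super range_inj_infinite by blast
  moreover have "f ` Pow {..\<xi>} \<subseteq> {..<max b b'}"
    using b(2) by (auto simp: less_max_iff_disj)
  then have "|Pow {..\<xi>}| \<le>o |{..<max b b'}|"
    using f(1) card_of_ordLeq by blast
  ultimately show thesis
    using that[of "max b b'"] b(1) b'(1) by simp
qed

end

section \<open>Blocks\<close>

text \<open>The length of a block is measured by cardinality rather than by order type: an interval of \<open>c\<close>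
  with more than \<open>|\<mu>|\<close> elements contains the first \<open>\<mu>\<close> successors of its left end.\<close>

definition hblock :: "'a::wellorder set \<Rightarrow> 'a \<Rightarrow> 'a set \<Rightarrow> 'a \<Rightarrow> 'a \<Rightarrow> bool" where
  "hblock B \<mu> c \<gamma> \<gamma>' \<longleftrightarrow>
     (\<forall>x\<in>c. \<gamma> < x \<and> x \<le> \<gamma>' \<and> \<not> limpt c x \<longrightarrow> x \<in> B) \<and> \<not> |c \<inter> {\<gamma>..\<gamma>'}| \<le>o |{..\<mu>}|"

text \<open>Being a limit point above \<gamma> depends only on the elements between \<gamma> and
  that point, so agreement on the interval is enough; a smaller \<mu>' only weakens the size
  requirement.\<close>

lemma hblock_transfer:
  assumes c: "hblock B \<mu> c \<gamma> \<gamma>'" and eq: "C \<inter> {\<gamma>..\<gamma>'} = c \<inter> {\<gamma>..\<gamma>'}" and le: "\<mu>' \<le> \<mu>"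
  shows "hblock B \<mu>' C \<gamma> \<gamma>'"
proof -
  have eq': "y \<in> C \<longleftrightarrow> y \<in> c" if "\<gamma> \<le> y" "y \<le> \<gamma>'" for y
    using eq that by (auto simp: set_eq_iff)
  have "x \<in> B" if x: "x \<in> C" "\<gamma> < x" "x \<le> \<gamma>'" "\<not> limpt C x" for x
  proof -
    have "\<not> limpt c x"
    proof
      assume l: "limpt c x"
      have "\<exists>y\<in>C. w < y \<and> y < x" if w: "w < x" for w
      proof -
        obtain y where "y \<in> c" "max w \<gamma> < y" "y < x"
          using l w x(2) unfolding limpt_def by (metis max_less_iff_conj)
        then show ?thesis
          using eq'[of y] x(3) by (intro bexI[of _ y]) auto
      qed
      then show False
        using x(2,4) unfolding limpt_def by blast
    qed
    then show ?thesis
      using c x eq'[of x] unfolding hblock_def by auto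
  qed
  moreover have "|{..\<mu>'}| \<le>o |{..\<mu>}|"
    using le by (intro card_of_mono1) auto
  then have "\<not> |C \<inter> {\<gamma>..\<gamma>'}| \<le>o |{..\<mu>'}|"
    using c ordLeq_transitive unfolding eq hblock_def by blast
  ultimately show ?thesis
    unfolding hblock_def by blast
qed

text \<open>Once the tail from \<gamma> on has an element below \<open>x\<close>, removing the
  elements below \<gamma> does not change whether \<open>x\<close> is a limit; so successors of the
  tail are nonlimits of \<open>C\<close> itself.\<close>

lemma succ_set_elem:
  fixes C :: "'a::wellorder set"
  assumes C: "C \<subseteq> {..<\<alpha>}" and x: "x \<in> succ_set \<sigma> (C - {..<\<gamma>})"
  obtains j where "j < \<sigma>" "x \<in> C" "\<gamma> < x" "\<not> limpt C x" "|C \<inter> {\<gamma>..<x}| =o |{..j}|"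
proof -
  let ?D = "C - {..<\<gamma>}"
  obtain j where j: "j < \<sigma>" "osuc j < otp ?D" "x = onth ?D (osuc j)"
    using x unfolding succ_set_def by blast
  have D: "?D \<subseteq> {..<\<alpha>}"
    using C by blast
  note o = onth_osuc[OF D j]
  obtain y where y: "y \<in> ?D" "y < x"
    using o(2) by blast
  have "\<gamma> < x"
    using y by (auto simp: not_less intro: order_le_less_trans)
  have "\<not> limpt C x"
  proof
    assume l: "limpt C x"
    have "\<exists>z\<in>?D. w < z \<and> z < x" if w: "w < x" for w
    proof -
      obtain z where "z \<in> C" "max w y < z" "z < x"
        using l w y(2) unfolding limpt_def by (metis max_less_iff_conj)
      then show ?thesis
        using y(1) by (intro bexI[of _ z]) auto
    qed
    then show False
      using o(3) y(2) unfolding limpt_def by blast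
  qed
  moreover have "?D \<inter> {..<x} = C \<inter> {\<gamma>..<x}"
    by auto
  ultimately show thesis
    using that[OF j(1)] o(1,4) \<open>\<gamma> < x\<close> by auto
qed

lemma hits_all_successors:
  assumes "limit_ord \<alpha>" "cofinal_in C \<alpha>" "\<And>x. x \<in> C \<Longrightarrow> \<not> limpt C x \<Longrightarrow> x \<in> B"
  shows "hits (Sigma_ord \<sigma>) C B \<alpha>"
proof -
  have C: "C \<subseteq> {..<\<alpha>}"
    using assms(2) unfolding cofinal_in_def by blast
  have "succ_set \<sigma> (C - {..<\<gamma>}) \<subseteq> B" for \<gamma>
    using succ_set_elem[OF C] assms(3) by blast
  then show ?thesis
    using osup_cofinal[OF assms(1,2)] by simp
qed

text \<open>A point of \<open>succ_set \<sigma>\<close> of the tail from \<gamma> on has at most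
  |\<open>{..\<sigma>}\<close>| predecessors in the tail. Beyond \<gamma>' it would have the whole
  block below it, which is larger; so it lies in the block and hence in \<open>B\<close>. Lengths
  \<mu> < \<alpha> suffice as \<open>otp C\<close> is at most \<alpha>.\<close>

lemma hits_blocks:
  assumes lim: "limit_ord \<alpha>" and C: "cofinal_in C \<alpha>"
    and blocks: "\<And>\<epsilon> \<mu>. \<epsilon> < \<alpha> \<Longrightarrow> \<mu> < \<alpha> \<Longrightarrow> \<exists>\<gamma>\<in>C. \<exists>\<gamma>'. \<epsilon> \<le> \<gamma> \<and> hblock B \<mu> C \<gamma> \<gamma>'"
  shows "hits Sigma_lt_infty C (B \<inter> {..<\<alpha>}) \<alpha>"
  unfolding hits.simps
proof (intro allI impI)
  have sub: "C \<subseteq> {..<\<alpha>}"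
    using C unfolding cofinal_in_def by blast
  fix \<sigma> assume "\<sigma> < otp C"
  then have s: "\<sigma> < \<alpha>"
    using otp_le[OF sub] by simp
  let ?X = "{\<gamma>\<in>C. succ_set \<sigma> (C - {..<\<gamma>}) \<subseteq> B \<inter> {..<\<alpha>}}"
  have "\<exists>\<gamma>\<in>?X. \<epsilon> \<le> \<gamma>" if e: "\<epsilon> < \<alpha>" for \<epsilon>
  proof -
    obtain \<gamma> \<gamma>' where g: "\<gamma> \<in> C" "\<epsilon> \<le> \<gamma>" "hblock B \<sigma> C \<gamma> \<gamma>'"
      using blocks[OF e s] by blast
    have "x \<in> B \<inter> {..<\<alpha>}" if x: "x \<in> succ_set \<sigma> (C - {..<\<gamma>})" for x
    proof -
      obtain j where j: "j < \<sigma>" "x \<in> C" "\<gamma> < x" "\<not> limpt C x" "|C \<inter> {\<gamma>..<x}| =o |{..j}|"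
        using succ_set_elem[OF sub x] .
      have "|{..j}| \<le>o |{..\<sigma>}|"
        using j(1) by (intro card_of_mono1) auto
      then have *: "|C \<inter> {\<gamma>..<x}| \<le>o |{..\<sigma>}|"
        using j(5) ordIso_ordLeq_trans by blast
      have "x \<le> \<gamma>'"
      proof (rule ccontr)
        assume "\<not> x \<le> \<gamma>'"
        then have "C \<inter> {\<gamma>..\<gamma>'} \<subseteq> C \<inter> {\<gamma>..<x}"
          by auto
        then have "|C \<inter> {\<gamma>..\<gamma>'}| \<le>o |{..\<sigma>}|"
          using * card_of_mono1 ordLeq_transitive by blast
        then show False
          using g(3) unfolding hblock_def by blast
      qed
      then show ?thesis
        using g(3) j(2-4) sub unfolding hblock_def by blast
    qed
    then show ?thesis
      using g by blast
  qed
  then have "cofinal_in ?X \<alpha>"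
    using sub unfolding cofinal_in_def by blast
  then show "osup ?X = \<alpha>"
    by (rule osup_cofinal[OF lim])
qed

lemma below_not_limpt:
  assumes "z \<in> Z"
  obtains y where "y \<in> Z" "y \<le> z" "\<not> limpt Z y"
proof -
  define y where "y = (LEAST y. y \<in> Z)"
  have "y \<in> Z" "y \<le> z"
    unfolding y_def using assms by (rule LeastI, rule Least_le)
  moreover have "\<not> limpt Z y"
    using not_less_Least[of _ "\<lambda>y. y \<in> Z"] unfolding y_def limpt_def by blast
  ultimately show thesis
    by (rule that)
qed

section \<open>Clubs and blocks obtained from nonreflection\<close>

locale nonreflecting_inaccessible = inaccessible \<kappa> for \<kappa> :: "'a::wellorder" +
  fixes S :: "'a set"
  assumes nonrefl: "nonreflecting \<kappa> S" and S_sub: "S \<subseteq> {..<\<kappa>}"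
begin

text \<open>Makes room for insertions: if \<open>g\<close> bounds the end of a block started at
  \<open>osuc z\<close>, the block ends before the next point of \<open>Z\<close>. The function
  \<open>n\<close> given to \<open>thinning\<close> picks points of \<open>E\<close> beyond \<xi>
  and \<open>g s\<close>.\<close>

lemma spread_out:
  assumes d: "\<delta> < \<kappa>" "limit_ord \<delta>" and xi: "\<xi> < \<delta>" and g: "\<forall>x<\<delta>. g x < \<delta>"
  obtains Z where "cofinal_in Z \<delta>" "sclosed S \<delta> Z" "Z \<subseteq> {\<xi><..}"
    "\<forall>z\<in>Z. \<forall>z'\<in>Z. z < z' \<longrightarrow> g (osuc z) < z'"
proof -
  obtain E where E: "cofinal_in E \<delta>" "sclosed S \<delta> E"
    using nonreflecting_avoiding[OF nonrefl d] .
  have "\<exists>e. e \<in> E \<and> s \<le> e \<and> \<xi> < e \<and> g s < e \<and> e < \<delta>" if s: "s < \<delta>" for s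
  proof -
    have "max s (max \<xi> (g s)) < \<delta>"
      using xi g s by simp
    from cofinal_greater[OF d(2) E(1) this] show ?thesis
      by (metis less_imp_le max_less_iff_conj)
  qed
  then obtain n where n: "\<And>s. s < \<delta> \<Longrightarrow> n s \<in> E \<and> s \<le> n s \<and> \<xi> < n s \<and> g s < n s \<and> n s < \<delta>"
    by metis
  have n': "n s < \<delta> \<and> (\<exists>e\<in>E. s \<le> e \<and> e \<le> n s)" if "s < \<delta>" for s
    using n[OF that] by blast
  obtain Z where Z: "cofinal_in Z \<delta>" "sclosed S \<delta> Z"
    "\<forall>\<beta>\<in>Z. \<not> limpt Z \<beta> \<longrightarrow> (\<exists>s\<le>\<beta>. \<beta> = n s)"
    "\<forall>z\<in>Z. \<forall>z'\<in>Z. z < z' \<longrightarrow> n (osuc z) \<le> z'"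
    using thinning[OF d(2) E(2) n'] .
  have less: "z < \<delta>" if "z \<in> Z" for z
    using Z(1) that unfolding cofinal_in_def by blast
  have "\<xi> < z" if z: "z \<in> Z" for z
  proof -
    obtain y where y: "y \<in> Z" "y \<le> z" "\<not> limpt Z y"
      using below_not_limpt[OF z] .
    then obtain s where "s \<le> y" "y = n s"
      using Z(3) by blast
    then have "\<xi> < y"
      using n[of s] less[OF y(1)] by auto
    then show ?thesis
      using y(2) by simp
  qed
  moreover have "g (osuc z) < z'" if z: "z \<in> Z" "z' \<in> Z" "z < z'" for z z'
    using Z(4)[rule_format, OF z] n[OF osuc_less_limit[OF d(2) less[OF z(1)]]] by (meson order_less_le_trans)
  ultimately show thesis
    using that[OF Z(1,2)] by blast
qed

text \<open>\<open>thinning\<close> is applied with values \<open>n s\<close> in \<open>B\<close>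
  that lie beyond a point of \<open>E\<close>: nonlimit points then come from \<open>B\<close>,
  while limit points are limits of \<open>E\<close> and miss \<open>S\<close>.\<close>

lemma successors_captured:
  assumes d: "\<delta> < \<kappa>" "limit_ord \<delta>" and xi: "\<xi> < \<delta>" and B: "\<And>x. x < \<delta> \<Longrightarrow> \<exists>b\<in>B. x < b \<and> b < \<delta>"
  obtains C where "cofinal_in C \<delta>" "sclosed S \<delta> C" "C \<subseteq> {\<xi><..}"
    "\<forall>x\<in>C. \<not> limpt C x \<longrightarrow> x \<in> B"
proof -
  obtain E where E: "cofinal_in E \<delta>" "sclosed S \<delta> E"
    using nonreflecting_avoiding[OF nonrefl d] .
  have "\<exists>b. b \<in> B \<and> \<xi> < b \<and> b < \<delta> \<and> (\<exists>e\<in>E. s \<le> e \<and> e \<le> b)" if s: "s < \<delta>" for s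
  proof -
    have "max s \<xi> < \<delta>"
      using xi s by simp
    from cofinal_greater[OF d(2) E(1) this] obtain e where e: "e \<in> E" "max s \<xi> < e" "e < \<delta>"
      by blast
    obtain b where "b \<in> B" "e < b" "b < \<delta>"
      using B[OF e(3)] by blast
    then show ?thesis
      using e by (intro exI[of _ b] conjI bexI[of _ e]) auto
  qed
  then obtain n where n: "\<And>s. s < \<delta> \<Longrightarrow> n s \<in> B \<and> \<xi> < n s \<and> n s < \<delta> \<and> (\<exists>e\<in>E. s \<le> e \<and> e \<le> n s)"
    by metis
  have n': "n s < \<delta> \<and> (\<exists>e\<in>E. s \<le> e \<and> e \<le> n s)" if "s < \<delta>" for s
    using n[OF that] by blast
  obtain C where C: "cofinal_in C \<delta>" "sclosed S \<delta> C"
    "\<forall>\<beta>\<in>C. \<not> limpt C \<beta> \<longrightarrow> (\<exists>s\<le>\<beta>. \<beta> = n s)"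
    "\<forall>z\<in>C. \<forall>z'\<in>C. z < z' \<longrightarrow> n (osuc z) \<le> z'"
    using thinning[OF d(2) E(2) n'] .
  have succ: "x \<in> B \<and> \<xi> < x" if x: "x \<in> C" "\<not> limpt C x" for x
  proof -
    obtain s where s: "s \<le> x" "x = n s"
      using C(3) x by blast
    have "x < \<delta>"
      using C(1) x(1) unfolding cofinal_in_def by blast
    then show ?thesis
      using n[of s] s by auto
  qed
  have "\<xi> < x" if x: "x \<in> C" for x
  proof -
    obtain y where "y \<in> C" "y \<le> x" "\<not> limpt C y"
      using below_not_limpt[OF x] .
    then show ?thesis
      using succ[of y] by auto
  qed
  then show thesis
    using that[OF C(1,2)] succ by blast
qed

text \<open>A club captured by \<open>B\<close> in a \<delta> of cofinality above |\<mu>| has more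
  than |\<mu>| elements. Some |\<open>Pow {..\<xi>}\<close>| many of them are bounded in \<delta>,
  so a bounded initial part is already larger than \<open>{..\<xi>}\<close>.\<close>

lemma single_block:
  assumes B: "cofinal_in B \<kappa>" and xi: "\<xi> < \<kappa>"
  shows "\<exists>c m. m < \<kappa> \<and> c \<subseteq> {\<xi><..m} \<and> sclosed S \<kappa> c \<and> (\<exists>\<gamma>\<in>c. \<exists>\<gamma>'\<in>c. hblock B \<xi> c \<gamma> \<gamma>')"
proof -
  obtain \<mu> where mu: "\<mu> < \<kappa>" "infinite {..<\<mu>}" "|Pow {..\<xi>}| \<le>o |{..<\<mu>}|"
    using exists_larger[OF xi] .
  obtain g where g: "\<And>x. x < \<kappa> \<Longrightarrow> g x \<in> B \<and> x < g x \<and> g x < \<kappa>"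
    using cofinal_greater[OF limit_kappa B] by metis
  \<comment> \<open>Closure under passing to a larger element of \<open>B\<close> makes
    \<open>B\<close> unbounded in \<delta>.\<close>
  obtain \<delta> where d: "\<delta> < \<kappa>" "\<xi> < \<delta>" "limit_ord \<delta>" "\<forall>x<\<delta>. g x < \<delta>"
    and cf: "\<And>A. A \<subseteq> {..<\<delta>} \<Longrightarrow> |A| \<le>o |{..<\<mu>}| \<Longrightarrow> \<exists>b<\<delta>. \<forall>a\<in>A. a < b"
    using large_cofinality_closure_point[OF mu(1,2) xi, of g] g by blast
  have "\<exists>b\<in>B. x < b \<and> b < \<delta>" if "x < \<delta>" for x
    using g[of x] d(1,4) that by (meson less_trans)
  then obtain C where C: "cofinal_in C \<delta>" "sclosed S \<delta> C" "C \<subseteq> {\<xi><..}"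
    "\<forall>x\<in>C. \<not> limpt C x \<longrightarrow> x \<in> B"
    using successors_captured[OF d(1,3,2)] by metis
  have sub: "C \<subseteq> {..<\<delta>}"
    using C(1) unfolding cofinal_in_def by blast
  have "\<not> |C| \<le>o |{..<\<mu>}|"
    using cf[OF sub] C(1) unfolding cofinal_in_def by (meson leD)
  then have "|{..<\<mu>}| \<le>o |C|"
    using ordLeq_total[OF card_of_Well_order card_of_Well_order] by blast
  then have "|Pow {..\<xi>}| \<le>o |C|"
    using mu(3) ordLeq_transitive by blast
  then obtain f where f: "inj_on f (Pow {..\<xi>})" "f ` Pow {..\<xi>} \<subseteq> C"
    using card_of_ordLeq[of "Pow {..\<xi>}" C] by blast
  have "|f ` Pow {..\<xi>}| \<le>o |{..<\<mu>}|"
    using card_of_image mu(3) by (rule ordLeq_transitive)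
  moreover have "f ` Pow {..\<xi>} \<subseteq> {..<\<delta>}"
    using f(2) sub by (rule subset_trans)
  ultimately obtain b where b: "b < \<delta>" "\<forall>a\<in>f ` Pow {..\<xi>}. a < b"
    using cf by blast
  then obtain \<gamma>' where g': "\<gamma>' \<in> C" "b \<le> \<gamma>'" "\<gamma>' < \<delta>"
    using C(1) unfolding cofinal_in_def by blast
  let ?c = "C \<inter> {..\<gamma>'}"
  \<comment> \<open>The least element of \<open>C\<close>, so that the interval from \<gamma> to
    \<gamma>' is the whole initial part.\<close>
  obtain \<gamma> where ga: "\<gamma> \<in> C" "\<gamma> \<le> \<gamma>'" "\<forall>x\<in>C. \<gamma> \<le> x"
    using LeastI[of "\<lambda>x. x \<in> C"] Least_le[of "\<lambda>x. x \<in> C"] g'(1) by metis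
  have "f ` Pow {..\<xi>} \<subseteq> ?c"
    using f(2) b(2) g'(2) by (meson Int_greatest atMost_iff less_imp_le order_trans subsetI)
  then have "|Pow {..\<xi>}| \<le>o |?c|"
    using f(1) card_of_ordLeq by blast
  then have large: "\<not> |?c| \<le>o |{..\<xi>}|"
    using card_of_Pow[of "{..\<xi>}"] not_ordLess_ordLeq ordLeq_transitive by blast
  have eq: "?c \<inter> {\<gamma>..\<gamma>'} = C \<inter> {\<gamma>..\<gamma>'}" "C \<inter> {\<gamma>..\<gamma>'} = ?c"
    using ga(3) by auto
  have "hblock B \<xi> C \<gamma> \<gamma>'"
    using large C(4) unfolding hblock_def eq(2) by blast
  then have "hblock B \<xi> ?c \<gamma> \<gamma>'"
    using eq(1) by (rule hblock_transfer) simp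
  moreover have "\<gamma> \<in> ?c" "\<gamma>' \<in> ?c"
    using ga g' by auto
  moreover have "sclosed S \<kappa> ?c"
    using sclosed_cut[OF C(2) g'(3)] d(1) by simp
  moreover have "?c \<subseteq> {\<xi><..\<gamma>'}"
    using C(3) by auto
  moreover have "\<gamma>' < \<kappa>"
    using g'(3) d(1) by simp
  ultimately show ?thesis
    by blast
qed

lemma sclosed_smaller: "sclosed S \<kappa> c \<Longrightarrow> \<delta> < \<kappa> \<Longrightarrow> c \<subseteq> {..<\<delta>} \<Longrightarrow> sclosed S \<delta> c"
  unfolding sclosed_def by (auto intro: less_trans)

text \<open>The blocks for the different \<open>i\<close> are placed in disjoint intervals of a closed set below an
  ordinal whose cofinality exceeds their number, so that some initial segment contains them all.\<close>

lemma all_blocks: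
  assumes B: "\<And>i. i < \<kappa> \<Longrightarrow> cofinal_in (B i) \<kappa>" and xi: "\<xi> < \<kappa>"
  shows "\<exists>c m. m < \<kappa> \<and> c \<subseteq> {\<xi><..m} \<and> sclosed S \<kappa> c \<and>
    (\<forall>i<\<xi>. \<exists>\<gamma>\<in>c. \<exists>\<gamma>'\<in>c. hblock (B i) \<xi> c \<gamma> \<gamma>')"
proof -
  have "\<exists>c m. m < \<kappa> \<and> c \<subseteq> {\<zeta><..m} \<and> sclosed S \<kappa> c \<and> (\<exists>\<gamma>\<in>c. \<exists>\<gamma>'\<in>c. hblock (B i) \<zeta> c \<gamma> \<gamma>')"
    if "i < \<kappa>" "\<zeta> < \<kappa>" for i \<zeta>
    using single_block[OF B that(2)] that(1) by blast
  then obtain c m where cm: "\<And>i \<zeta>. i < \<kappa> \<Longrightarrow> \<zeta> < \<kappa> \<Longrightarrow> m i \<zeta> < \<kappa> \<and> c i \<zeta> \<subseteq> {\<zeta><..m i \<zeta>} \<and>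
      sclosed S \<kappa> (c i \<zeta>) \<and> (\<exists>\<gamma>\<in>c i \<zeta>. \<exists>\<gamma>'\<in>c i \<zeta>. hblock (B i) \<zeta> (c i \<zeta>) \<gamma> \<gamma>')"
    by metis
  \<comment> \<open>By regularity the blocks for all \<open>i < \<xi>\<close> with the same starting
    point \<zeta> have a common bound; closure of \<delta> under it will let any of them be
    placed.\<close>
  have "\<exists>b<\<kappa>. \<forall>i<\<xi>. m i \<zeta> < b" if z: "\<zeta> < \<kappa>" for \<zeta>
    using image_bounded[OF small_lessThan[OF xi], of "\<lambda>i. m i \<zeta>"] cm[OF _ z] xi
    by (metis lessThan_iff less_trans)
  then obtain g where g: "\<And>\<zeta>. \<zeta> < \<kappa> \<Longrightarrow> g \<zeta> < \<kappa> \<and> (\<forall>i<\<xi>. m i \<zeta> < g \<zeta>)"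
    by metis
  obtain \<mu> where mu: "\<mu> < \<kappa>" "infinite {..<\<mu>}" "|Pow {..\<xi>}| \<le>o |{..<\<mu>}|"
    using exists_larger[OF xi] .
  have "|{..<\<xi>}| \<le>o |{..\<xi>}|"
    by (rule card_of_mono1) auto
  then have xi_mu: "|{..<\<xi>}| \<le>o |{..<\<mu>}|"
    by (rule ordLeq_transitive[OF _ ordLeq_transitive[OF ordLess_imp_ordLeq[OF card_of_Pow] mu(3)]])
  obtain \<delta> where d: "\<delta> < \<kappa>" "\<xi> < \<delta>" "limit_ord \<delta>" "\<forall>x<\<delta>. g x < \<delta>"
    and cf: "\<And>A. A \<subseteq> {..<\<delta>} \<Longrightarrow> |A| \<le>o |{..<\<mu>}| \<Longrightarrow> \<exists>b<\<delta>. \<forall>a\<in>A. a < b"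
    using large_cofinality_closure_point[OF mu(1,2) xi, of g] g by blast
  obtain Z where Z: "cofinal_in Z \<delta>" "sclosed S \<delta> Z" "Z \<subseteq> {\<xi><..}"
    and sep: "\<forall>z\<in>Z. \<forall>z'\<in>Z. z < z' \<longrightarrow> g (osuc z) < z'"
    using spread_out[OF d(1,3,2,4)] .
  have sub: "Z \<subseteq> {..<\<delta>}"
    using Z(1) unfolding cofinal_in_def by blast
  have "\<not> |Z| \<le>o |{..<\<mu>}|"
    using cf[OF sub] Z(1) unfolding cofinal_in_def by (meson leD)
  then have "|{..<\<mu>}| \<le>o |Z|"
    using ordLeq_total[OF card_of_Well_order card_of_Well_order] by blast
  then have "|{..<\<xi>}| \<le>o |Z|"
    using xi_mu ordLeq_transitive by blast
  \<comment> \<open>Each index \<open>i < \<xi>\<close> receives its own point \<open>f i\<close> of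
    \<open>Z\<close>, above which its block is put.\<close>
  then obtain f where f: "inj_on f {..<\<xi>}" "f ` {..<\<xi>} \<subseteq> Z"
    using card_of_ordLeq[of "{..<\<xi>}" Z] by blast
  \<comment> \<open>The union has at most one member since \<open>f\<close> is injective; points of
    \<open>Z\<close> outside the range of \<open>f\<close> get the empty block.\<close>
  define d where "d z = (\<Union>i\<in>{i. i < \<xi> \<and> f i = z}. c i (osuc z))" for z
  have d_f: "d (f i) = c i (osuc (f i))" if "i < \<xi>" for i
    using f(1) that unfolding d_def by (auto simp: inj_on_def)
  have d_cases: "d z = {} \<or> (\<exists>i<\<xi>. z = f i)" for z
    unfolding d_def by auto
  have block: "osuc z < \<delta>" "d z \<subseteq> {z<..}" "d z \<subseteq> {..<g (osuc z)}" "sclosed S \<delta> (d z)" if z: "z \<in> Z" for z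
  proof -
    have zd: "z < \<delta>"
      using sub z by blast
    then show o: "osuc z < \<delta>"
      by (rule osuc_less_limit[OF d(3)])
    then have ok: "osuc z < \<kappa>" and gz: "g (osuc z) < \<delta>"
      using d(1,4) by auto
    show "d z \<subseteq> {z<..}" "d z \<subseteq> {..<g (osuc z)}" "sclosed S \<delta> (d z)"
    proof -
      have "d z \<subseteq> {z<..} \<and> d z \<subseteq> {..<g (osuc z)} \<and> sclosed S \<delta> (d z)"
      proof (cases "d z = {}")
        case True
        then show ?thesis
          by (auto simp: sclosed_def limpt_def)
      next
        case False
        then obtain i where i: "i < \<xi>" "z = f i"
          using d_cases by blast
        then have dz: "d z = c i (osuc z)"
          using d_f by simp
        have iK: "i < \<kappa>"
          using i(1) xi by simp
        have cc: "sclosed S \<kappa> (c i (osuc z))"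
          using cm[OF iK ok] by blast
        have "m i (osuc z) < g (osuc z)"
          using g[OF ok] i(1) by blast
        then have "d z \<subseteq> {z<..}" "d z \<subseteq> {..<g (osuc z)}"
          using cm[OF iK ok] less_osuc[OF zd] unfolding dz by fastforce+
        moreover have "sclosed S \<delta> (d z)"
          using calculation(2) gz unfolding dz by (intro sclosed_smaller[OF cc d(1)]) auto
        ultimately show ?thesis
          by blast
      qed
      then show "d z \<subseteq> {z<..}" "d z \<subseteq> {..<g (osuc z)}" "sclosed S \<delta> (d z)"
        by auto
    qed
  qed
  have sep': "d z \<subseteq> {..<z'}" if z: "z \<in> Z" "z' \<in> Z" "z < z'" for z z'
    using block(3)[OF z(1)] sep[rule_format, OF z] by (auto intro: less_trans)
  define C where "C = Z \<union> (\<Union>z\<in>Z. d z)"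
  have "\<forall>z\<in>Z. sclosed S \<delta> (d z) \<and> d z \<subseteq> {z<..}" "\<forall>z\<in>Z. \<forall>z'\<in>Z. z < z' \<longrightarrow> d z \<subseteq> {..<z'}"
    using block(2,4) sep' by blast+
  note C = filling[OF Z(1,2) this C_def]
  have "|f ` {..<\<xi>}| \<le>o |{..<\<mu>}|"
    using card_of_image xi_mu by (rule ordLeq_transitive)
  moreover have "f ` {..<\<xi>} \<subseteq> {..<\<delta>}"
    using f(2) sub by (rule subset_trans)
  ultimately obtain b where b: "b < \<delta>" "\<forall>a\<in>f ` {..<\<xi>}. a < b"
    using cf by blast
  \<comment> \<open>The positions used are bounded in \<delta> by its cofinality, so cutting at a
    point \<open>w\<close> of \<open>Z\<close> beyond them keeps every block complete.\<close>
  then obtain w where w: "w \<in> Z" "b \<le> w" "w < \<delta>"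
    using Z(1) unfolding cofinal_in_def by blast
  let ?c = "C \<inter> {..w}"
  have "\<exists>\<gamma>\<in>?c. \<exists>\<gamma>'\<in>?c. hblock (B i) \<xi> ?c \<gamma> \<gamma>'" if i: "i < \<xi>" for i
  proof -
    let ?z = "f i"
    have z: "?z \<in> Z" "?z < w"
      using f(2) i b(2) w(2) by (auto intro: order_less_le_trans)
    have "osuc ?z < \<kappa>"
      using block(1)[OF z(1)] d(1) by simp
    then obtain \<gamma> \<gamma>' where ga: "\<gamma> \<in> d ?z" "\<gamma>' \<in> d ?z" "hblock (B i) (osuc ?z) (d ?z) \<gamma> \<gamma>'"
      using cm[of i "osuc ?z"] less_trans[OF i xi] unfolding d_f[OF i] by blast
    have lt: "\<gamma> < w" "\<gamma>' < w"
      using sep'[OF z(1) w(1) z(2)] ga(1,2) by auto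
    have "?c \<inter> {\<gamma>..\<gamma>'} = C \<inter> {\<gamma>..\<gamma>'}"
      using lt(2) by auto
    then have "?c \<inter> {\<gamma>..\<gamma>'} = d ?z \<inter> {\<gamma>..\<gamma>'}"
      using C(3)[OF z(1) ga(1,2)] by simp
    \<comment> \<open>The block at \<open>f i\<close> was built for the parameter
      \<open>osuc (f i)\<close>, which is at least \<xi> because \<open>Z\<close> lies above
      \<xi>.\<close>
    moreover have "\<xi> \<le> osuc ?z"
      using Z(3) z less_osuc[OF z(2)] by (auto intro: less_imp_le less_trans)
    ultimately have "hblock (B i) \<xi> ?c \<gamma> \<gamma>'"
      using hblock_transfer[OF ga(3)] by blast
    moreover have "\<gamma> \<in> ?c" "\<gamma>' \<in> ?c"
      using ga(1,2) z(1) lt unfolding C_def by auto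
    ultimately show ?thesis
      by blast
  qed
  moreover have "sclosed S \<kappa> ?c"
    using sclosed_cut[OF C(2) w(3)] d(1) by simp
  moreover have "?c \<subseteq> {\<xi><..w}"
  proof
    fix x assume x: "x \<in> ?c"
    then obtain z where "z \<in> Z" "z \<le> x"
      using block(2) less_imp_le unfolding C_def by blast
    then have "\<xi> < x"
      using Z(3) by (meson greaterThan_iff order_less_le_trans subsetD)
    then show "x \<in> {\<xi><..w}"
      using x by simp
  qed
  moreover have "w < \<kappa>"
    using w(3) d(1) by simp
  ultimately show ?thesis
    by blast
qed

text \<open>The block above \<open>z\<close> serves every \<open>i\<close> below
  \<open>osuc z\<close> at once, and its size exceeds |\<open>{..osuc z}\<close>|. Any
  \<open>i\<close>, \<epsilon> and \<mu> below \<alpha> are therefore handled by one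
  \<open>z\<close> beyond all three, whatever the cofinality of \<alpha>.\<close>

lemma club_with_blocks:
  assumes a: "\<alpha> < \<kappa>" "limit_ord \<alpha>"
    and c: "\<And>\<xi>. \<xi> < \<alpha> \<Longrightarrow> m \<xi> < \<alpha> \<and> c \<xi> \<subseteq> {\<xi><..m \<xi>} \<and> sclosed S \<kappa> (c \<xi>) \<and>
      (\<forall>i<\<xi>. \<exists>\<gamma>\<in>c \<xi>. \<exists>\<gamma>'\<in>c \<xi>. hblock (B i) \<xi> (c \<xi>) \<gamma> \<gamma>')"
  obtains C where "cofinal_in C \<alpha>" "sclosed S \<alpha> C"
    "\<forall>i<\<alpha>. hits Sigma_lt_infty C (B i \<inter> {..<\<alpha>}) \<alpha>"
proof -
  have ma: "\<forall>x<\<alpha>. m x < \<alpha>"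
    using c by blast
  obtain x0 where "x0 < \<alpha>"
    using a(2) unfolding limit_ord_def by blast
  then obtain Z where Z: "cofinal_in Z \<alpha>" "sclosed S \<alpha> Z"
    and sep: "\<forall>z\<in>Z. \<forall>z'\<in>Z. z < z' \<longrightarrow> m (osuc z) < z'"
    using spread_out[OF a _ ma] by metis
  define d where "d z = c (osuc z)" for z
  have o: "z < osuc z" "osuc z < \<alpha>" if "z \<in> Z" for z
    using Z(1) that osuc_less_limit[OF a(2)] less_osuc unfolding cofinal_in_def by blast+
  have d: "sclosed S \<alpha> (d z)" "d z \<subseteq> {z<..}" if z: "z \<in> Z" for z
  proof -
    have "d z \<subseteq> {..<\<alpha>}"
      using c[OF o(2)[OF z]] unfolding d_def by fastforce
    then show "sclosed S \<alpha> (d z)"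
      using c[OF o(2)[OF z]] sclosed_smaller[of "c (osuc z)"] a(1) unfolding d_def by blast
    show "d z \<subseteq> {z<..}"
      using c[OF o(2)[OF z]] o(1)[OF z] unfolding d_def by fastforce
  qed
  have sep': "d z \<subseteq> {..<z'}" if z: "z \<in> Z" "z' \<in> Z" "z < z'" for z z'
    using c[OF o(2)[OF z(1)]] sep[rule_format, OF z] unfolding d_def by fastforce
  define C where "C = Z \<union> (\<Union>z\<in>Z. d z)"
  have "\<forall>z\<in>Z. sclosed S \<alpha> (d z) \<and> d z \<subseteq> {z<..}" "\<forall>z\<in>Z. \<forall>z'\<in>Z. z < z' \<longrightarrow> d z \<subseteq> {..<z'}"
    using d sep' by blast+
  note C = filling[OF Z this C_def]
  have "hits Sigma_lt_infty C (B i \<inter> {..<\<alpha>}) \<alpha>" if i: "i < \<alpha>" for i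
  proof (rule hits_blocks[OF a(2) C(1)])
    fix \<epsilon> \<mu> assume "\<epsilon> < \<alpha>" "\<mu> < \<alpha>"
    then have "max i (max \<epsilon> \<mu>) < \<alpha>"
      using i by simp
    then obtain z where z: "z \<in> Z" "max i (max \<epsilon> \<mu>) < z"
      using cofinal_greater[OF a(2) Z(1)] by blast
    have "i < osuc z"
      using z(2) o(1)[OF z(1)] by auto
    then obtain \<gamma> \<gamma>' where ga: "\<gamma> \<in> d z" "\<gamma>' \<in> d z" "hblock (B i) (osuc z) (d z) \<gamma> \<gamma>'"
      using c[OF o(2)[OF z(1)]] unfolding d_def by blast
    have "\<mu> \<le> osuc z"
      using z(2) o(1)[OF z(1)] by auto
    then have "hblock (B i) \<mu> C \<gamma> \<gamma>'"
      using hblock_transfer[OF ga(3) C(3)[OF z(1) ga(1,2)]] by blast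
    moreover have "\<gamma> \<in> C"
      using ga(1) z(1) unfolding C_def by blast
    moreover have "\<epsilon> \<le> \<gamma>"
      using d(2)[OF z(1)] ga(1) z(2) by (auto intro: less_imp_le less_trans)
    ultimately show "\<exists>\<gamma>\<in>C. \<exists>\<gamma>'. \<epsilon> \<le> \<gamma> \<and> hblock (B i) \<mu> C \<gamma> \<gamma>'"
      by blast
  qed
  then show thesis
    using that C(1,2) by blast
qed

section \<open>The proxy principle\<close>

lemma sclosed_Int_limpt:
  assumes C: "sclosed S \<alpha> C" and l: "limpt C \<beta>" "\<beta> < \<alpha>"
  shows "cofinal_in (C \<inter> {..<\<beta>}) \<beta>" "sclosed S \<beta> (C \<inter> {..<\<beta>})"
proof -
  show "cofinal_in (C \<inter> {..<\<beta>}) \<beta>"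
    using l(1) unfolding cofinal_in_def limpt_def by (auto intro: less_imp_le)
  show "sclosed S \<beta> (C \<inter> {..<\<beta>})"
    using C l(2) unfolding sclosed_def by (auto simp: limpt_cut intro: less_trans)
qed

lemma avoiding_K_set:
  assumes "\<alpha> < \<kappa>" "limit_ord \<alpha>" "cofinal_in C \<alpha>" "sclosed S \<alpha> C"
  shows "C \<in> K_set \<kappa>" "osup C = \<alpha>"
proof -
  show o: "osup C = \<alpha>"
    using osup_cofinal assms(2,3) by blast
  have "C \<noteq> {}"
    using assms(2,3) unfolding limit_ord_def cofinal_in_def by blast
  moreover have "C \<subseteq> {..<\<alpha>}" "C \<subseteq> {..<\<kappa>}"
    using assms(1,3) unfolding cofinal_in_def by auto
  moreover have "club_in C \<alpha>"
    using assms(3,4) unfolding club_in_limpt sclosed_def by blast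
  ultimately show "C \<in> K_set \<kappa>"
    using o unfolding K_set_def by auto
qed

lemma hits_mono:
  assumes C: "C \<subseteq> {..<\<alpha>}" and B: "B \<subseteq> B'" and h: "hits \<sigma> C B \<alpha>"
  shows "hits \<sigma> C B' \<alpha>"
proof -
  have mono: "osup {\<gamma>\<in>C. succ_set \<tau> (C - {..<\<gamma>}) \<subseteq> B'} = \<alpha>"
    if "osup {\<gamma>\<in>C. succ_set \<tau> (C - {..<\<gamma>}) \<subseteq> B} = \<alpha>" for \<tau>
  proof -
    let ?X = "{\<gamma>\<in>C. succ_set \<tau> (C - {..<\<gamma>}) \<subseteq> B}" and ?Y = "{\<gamma>\<in>C. succ_set \<tau> (C - {..<\<gamma>}) \<subseteq> B'}"
    have "?Y \<subseteq> {..<\<alpha>}" "?X \<subseteq> ?Y"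
      using C B by auto
    then have ub: "\<forall>a\<in>?Y. a \<le> \<alpha>"
      by (auto simp del: mem_Collect_eq intro: less_imp_le)
    then have "\<forall>a\<in>?X. a \<le> osup ?Y"
      using osup_upper[OF ub] \<open>?X \<subseteq> ?Y\<close> by blast
    then have "osup ?X \<le> osup ?Y"
      by (rule osup_le)
    with osup_le[OF ub] that show ?thesis
      by simp
  qed
  show ?thesis
    using h by (cases \<sigma>) (simp_all add: mono)
qed

text \<open>The club at \<alpha> has to be fixed before the sets \<open>B i\<close> are given. It is
  made to hit the guesses \<open>b \<alpha> i\<close>, which depend on \<alpha> and \<open>i\<close>
  only, and \<open>hits_mono\<close> passes to \<open>B i\<close> wherever the guesses are included
  in it.\<close>

lemma P_minus_intro:
  assumes guess: "\<And>B. \<forall>i<\<theta>. cofinal_in (B i) \<kappa> \<Longrightarrow>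
    stationary_in {\<alpha>\<in>S. limit_ord \<alpha> \<and> (\<forall>i<min \<alpha> \<theta>. b \<alpha> i \<subseteq> B i) \<and>
      (\<exists>C. cofinal_in C \<alpha> \<and> sclosed S \<alpha> C \<and> (\<forall>i<min \<alpha> \<theta>. hits \<sigma> C (b \<alpha> i) \<alpha>))} \<kappa>"
  shows "P_minus \<kappa> S \<theta> \<sigma>"
proof -
  define ok where "ok \<alpha> C \<longleftrightarrow> cofinal_in C \<alpha> \<and> sclosed S \<alpha> C" for \<alpha> C
  define good where "good \<alpha> C \<longleftrightarrow> ok \<alpha> C \<and> (\<forall>i<min \<alpha> \<theta>. hits \<sigma> C (b \<alpha> i) \<alpha>)" for \<alpha> C
  \<comment> \<open>Where no club hits the guesses, an arbitrary one avoiding \<open>S\<close> is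
    the default, since \<open>\<C> \<alpha>\<close> must be nonempty at every limit ordinal.\<close>
  define c where "c \<alpha> = (if \<exists>C. good \<alpha> C then SOME C. good \<alpha> C else SOME C. ok \<alpha> C)" for \<alpha>
  define \<C> where "\<C> \<alpha> = (if \<alpha> \<in> S then {c \<alpha>} else {C. ok \<alpha> C})" for \<alpha>
  have good_c: "good \<alpha> (c \<alpha>)" if "good \<alpha> C" for \<alpha> C
  proof -
    have "c \<alpha> = (SOME C. good \<alpha> C)"
      using that unfolding c_def by auto
    then show ?thesis
      using someI[of "good \<alpha>", OF that] by simp
  qed
  have ok_c: "ok \<alpha> (c \<alpha>)" if a: "\<alpha> < \<kappa>" "limit_ord \<alpha>" for \<alpha>
  proof (cases "\<exists>C. good \<alpha> C")
    case True
    then show ?thesis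
      using good_c unfolding good_def by blast
  next
    case False
    obtain E where "ok \<alpha> E"
      using nonreflecting_avoiding[OF nonrefl a] unfolding ok_def by blast
    then have "ok \<alpha> (SOME C. ok \<alpha> C)"
      by (rule someI)
    moreover have "c \<alpha> = (SOME C. ok \<alpha> C)"
      unfolding c_def by (rule if_not_P[OF False])
    ultimately show ?thesis
      by simp
  qed
  have ok: "ok \<alpha> C" if "\<alpha> < \<kappa>" "limit_ord \<alpha>" "C \<in> \<C> \<alpha>" for \<alpha> C
    using that ok_c unfolding \<C>_def by (auto split: if_splits)
  have local: "\<C> \<alpha> \<subseteq> {C \<in> K_set \<kappa>. osup C = \<alpha>} \<and> \<C> \<alpha> \<noteq> {} \<and> |\<C> \<alpha>| <o ord_rel \<kappa> \<and>
      (\<forall>C\<in>\<C> \<alpha>. \<forall>\<alpha>'\<in>acc C. \<exists>D\<in>\<C> \<alpha>'. sq_initial S D C)" if "\<alpha> \<in> acc {..<\<kappa>}" for \<alpha>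
  proof (intro conjI ballI)
    have a: "\<alpha> < \<kappa>" "limit_ord \<alpha>"
      using that unfolding acc_ordinals by auto
    show "\<C> \<alpha> \<subseteq> {C \<in> K_set \<kappa>. osup C = \<alpha>}"
      using ok[OF a] avoiding_K_set[OF a] unfolding ok_def by blast
    show "\<C> \<alpha> \<noteq> {}"
      using ok_c[OF a] unfolding \<C>_def by auto
    have "\<C> \<alpha> \<subseteq> Pow {..<\<alpha>}"
      using ok[OF a] unfolding ok_def cofinal_in_def by blast
    then show "|\<C> \<alpha>| <o ord_rel \<kappa>"
      unfolding less_ord_rel_iff using small_Pow[OF a(1)] card_of_mono1 ordLeq_ordLess_trans by blast
    fix C \<beta> assume C: "C \<in> \<C> \<alpha>" and "\<beta> \<in> acc C"
    then have b: "\<beta> \<in> C" "limpt C \<beta>"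
      unfolding acc_limpt by auto
    have "ok \<alpha> C"
      using ok[OF a C] .
    then have C: "sclosed S \<alpha> C" and ba: "\<beta> < \<alpha>"
      using b(1) unfolding ok_def cofinal_in_def by auto
    \<comment> \<open>Outside \<open>S\<close> the family \<open>\<C> \<beta>\<close> is the full
      one, so it contains the initial segment of \<open>C\<close>.\<close>
    then have "\<beta> \<notin> S"
      using b(2) unfolding sclosed_def by blast
    moreover have "ok \<beta> (C \<inter> {..<\<beta>})"
      unfolding ok_def using sclosed_Int_limpt[OF C b(2) ba] by blast
    moreover have "osup (C \<inter> {..<\<beta>}) = \<beta>"
      using b(2) unfolding limpt_iff_osup by blast
    ultimately show "\<exists>D\<in>\<C> \<beta>. sq_initial S D C"
      unfolding sq_initial_def \<C>_def by (intro bexI[of _ "C \<inter> {..<\<beta>}"]) auto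
  qed
  have global: "stationary_in
      {\<alpha>\<in>S. card (\<C> \<alpha>) = 1 \<and> (\<forall>C\<in>\<C> \<alpha>. \<forall>i<min \<alpha> \<theta>. hits \<sigma> C (B i) \<alpha>)} \<kappa>"
    (is "stationary_in ?T \<kappa>") if B: "\<forall>i<\<theta>. cofinal_in (B i) \<kappa>" for B
  proof -
    let ?G = "{\<alpha>\<in>S. limit_ord \<alpha> \<and> (\<forall>i<min \<alpha> \<theta>. b \<alpha> i \<subseteq> B i) \<and>
      (\<exists>C. cofinal_in C \<alpha> \<and> sclosed S \<alpha> C \<and> (\<forall>i<min \<alpha> \<theta>. hits \<sigma> C (b \<alpha> i) \<alpha>))}"
    have G: "stationary_in ?G \<kappa>"
      using guess[OF B] .
    have "?G \<subseteq> ?T"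
    proof
      fix \<alpha> assume a: "\<alpha> \<in> ?G"
      then have "\<exists>C. good \<alpha> C"
        unfolding good_def ok_def by blast
      then have g: "good \<alpha> (c \<alpha>)"
        using good_c by blast
      have "hits \<sigma> (c \<alpha>) (B i) \<alpha>" if i: "i < min \<alpha> \<theta>" for i
      proof (rule hits_mono)
        show "b \<alpha> i \<subseteq> B i"
          using a i by auto
        show "c \<alpha> \<subseteq> {..<\<alpha>}" "hits \<sigma> (c \<alpha>) (b \<alpha> i) \<alpha>"
          using g i unfolding good_def ok_def cofinal_in_def by auto
      qed
      then show "\<alpha> \<in> ?T"
        using a unfolding \<C>_def by auto
    qed
    then show ?thesis
      by (rule stationary_mono[OF G]) (use S_sub in blast)
  qed
  show ?thesis
    unfolding P_minus_def
  proof (intro exI[of _ \<C>] conjI ballI allI impI)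
    show "stationary_in {\<alpha>\<in>S. card (\<C> \<alpha>) = 1 \<and> (\<forall>C\<in>\<C> \<alpha>. \<forall>i<min \<alpha> \<theta>. hits \<sigma> C (B i) \<alpha>)} \<kappa>"
      if "\<forall>i<\<theta>. cofinal_in (B i) \<kappa>" for B
      using global[OF that] .
  qed (use local in blast)+
qed

section \<open>Guessing with the diamond sequence\<close>

lemma guessed_single:
  assumes "diamond \<kappa> S"
  shows "P_minus \<kappa> S (osuc ozero) (Sigma_ord \<kappa>)"
proof -
  obtain A where A: "\<And>X. X \<subseteq> {..<\<kappa>} \<Longrightarrow> stationary_in {\<alpha>\<in>S. X \<inter> {..<\<alpha>} = A \<alpha>} \<kappa>"
    using assms unfolding diamond_def by blast
  have zero: "ozero < \<kappa>"
    using limit_kappa unfolding limit_ord_def ozero_less_iff by blast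
  show ?thesis
  proof (rule P_minus_intro[of _ "\<lambda>\<alpha> i. A \<alpha>"])
    fix B :: "'a \<Rightarrow> 'a set" assume B: "\<forall>i < osuc ozero. cofinal_in (B i) \<kappa>"
    \<comment> \<open>\<open>osuc ozero\<close> is the ordinal 1, so \<open>B ozero\<close> is the
      only set to be captured.\<close>
    have one: "i = ozero" if "i < osuc ozero" for i :: 'a
      using that less_osuc_iff[OF zero] ozero_le antisym by blast
    define X where "X = B ozero"
    have X: "cofinal_in X \<kappa>"
      using B less_osuc[OF zero] unfolding X_def by blast
    then have "X \<subseteq> {..<\<kappa>}"
      unfolding cofinal_in_def by blast
    obtain g where g: "\<And>x. x < \<kappa> \<Longrightarrow> g x \<in> X \<and> x < g x \<and> g x < \<kappa>"
      using cofinal_greater[OF limit_kappa X] by metis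
    \<comment> \<open>Closure of \<alpha> under \<open>g\<close> makes the guess
      \<open>A \<alpha>\<close>, which is \<open>X\<close> cut at \<alpha>, unbounded in
      \<alpha>.\<close>
    let ?G = "{\<alpha>\<in>{\<alpha>\<in>S. X \<inter> {..<\<alpha>} = A \<alpha>}. limit_ord \<alpha> \<and> (\<forall>x<\<alpha>. g x < \<alpha>)}"
    let ?H = "{\<alpha>\<in>S. limit_ord \<alpha> \<and> (\<forall>i<min \<alpha> (osuc ozero). A \<alpha> \<subseteq> B i) \<and>
      (\<exists>C. cofinal_in C \<alpha> \<and> sclosed S \<alpha> C \<and> (\<forall>i<min \<alpha> (osuc ozero). hits (Sigma_ord \<kappa>) C (A \<alpha>) \<alpha>))}"
    have st: "stationary_in ?G \<kappa>"
      using stationary_closure[OF A[OF \<open>X \<subseteq> {..<\<kappa>}\<close>], of g] g by blast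
    have "?G \<subseteq> ?H"
    proof
      fix \<alpha> assume a: "\<alpha> \<in> ?G"
      then have a': "\<alpha> < \<kappa>" "limit_ord \<alpha>" "X \<inter> {..<\<alpha>} = A \<alpha>"
        using S_sub by auto
      obtain x0 where x0: "x0 < \<alpha>"
        using a'(2) unfolding limit_ord_def by blast
      have "\<exists>y\<in>A \<alpha>. x < y \<and> y < \<alpha>" if x: "x < \<alpha>" for x
      proof -
        have "g x \<in> X" "x < g x" "g x < \<alpha>"
          using g[OF less_trans[OF x a'(1)]] a x by auto
        then show ?thesis
          using a'(3) by blast
      qed
      then obtain C where C: "cofinal_in C \<alpha>" "sclosed S \<alpha> C" "\<forall>x\<in>C. \<not> limpt C x \<longrightarrow> x \<in> A \<alpha>"
        using successors_captured[OF a'(1,2) x0] by metis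
      then have "hits (Sigma_ord \<kappa>) C (A \<alpha>) \<alpha>"
        using hits_all_successors[OF a'(2)] by blast
      moreover have "A \<alpha> \<subseteq> B i" if "i < min \<alpha> (osuc ozero)" for i
        using a'(3) one[of i] that unfolding X_def by auto
      ultimately show "\<alpha> \<in> ?H"
        using a C(1,2) by blast
    qed
    then show "stationary_in ?H \<kappa>"
      by (rule stationary_mono[OF st]) (use S_sub in blast)
  qed
qed

text \<open>The whole sequence is guessed as one set \<open>X\<close>, the image under
  \<open>p\<close> of the pairs \<open>(i, x)\<close> with \<open>x\<close> in \<open>B i\<close>.
  At an \<alpha> closed under \<open>p\<close> a correct guess decodes to \<open>B i\<close> cut at
  \<alpha> for every \<open>i < \<alpha>\<close>.\<close>

lemma guessed_sequence:
  assumes "diamond \<kappa> S"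
  shows "P_minus \<kappa> S \<kappa> Sigma_lt_infty"
proof -
  obtain A where A: "\<And>X. X \<subseteq> {..<\<kappa>} \<Longrightarrow> stationary_in {\<alpha>\<in>S. X \<inter> {..<\<alpha>} = A \<alpha>} \<kappa>"
    using assms unfolding diamond_def by blast
  have "|{..<\<kappa>} \<times> {..<\<kappa>}| \<le>o |{..<\<kappa>}|"
    using card_of_Times_same_infinite[OF infinite_kappa] ordIso_imp_ordLeq by blast
  then obtain p where p: "inj_on p ({..<\<kappa>} \<times> {..<\<kappa>})" "p ` ({..<\<kappa>} \<times> {..<\<kappa>}) \<subseteq> {..<\<kappa>}"
    using card_of_ordLeq[of "{..<\<kappa>} \<times> {..<\<kappa>}" "{..<\<kappa>}"] by blast
  have p_less: "p (i, x) < \<kappa>" if "i < \<kappa>" "x < \<kappa>" for i x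
    using p(2) that by blast
  have "\<exists>u<\<kappa>. \<forall>i\<le>y. \<forall>x\<le>y. p (i, x) < u" if y: "y < \<kappa>" for y
  proof -
    have "\<exists>u<\<kappa>. \<forall>x\<in>{..y}. p (i, x) < u" if i: "i \<in> {..y}" for i
    proof -
      have "p (i, x) < \<kappa>" if "x \<in> {..y}" for x
        using p_less i y that by auto
      then show ?thesis
        using image_bounded[OF small_atMost[OF y], of "\<lambda>x. p (i, x)"] by metis
    qed
    then obtain u where u: "\<And>i. i \<in> {..y} \<Longrightarrow> u i < \<kappa> \<and> (\<forall>x\<in>{..y}. p (i, x) < u i)"
      by metis
    then obtain v where "v < \<kappa>" "\<forall>i\<in>{..y}. u i < v"
      using image_bounded[OF small_atMost[OF y], of u] by metis
    then show ?thesis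
      using u by (intro exI[of _ v]) (auto intro: less_trans)
  qed
  \<comment> \<open>\<open>q\<close> reduces closure under the binary \<open>p\<close> to closure
    under a unary function, through the maximum of \<open>i\<close> and \<open>x\<close>.\<close>
  then obtain q where q: "\<And>y. y < \<kappa> \<Longrightarrow> q y < \<kappa> \<and> (\<forall>i\<le>y. \<forall>x\<le>y. p (i, x) < q y)"
    by metis
  show ?thesis
  proof (rule P_minus_intro[of _ "\<lambda>\<alpha> i. {x. x < \<alpha> \<and> p (i, x) \<in> A \<alpha>}"])
    fix B :: "'a \<Rightarrow> 'a set" assume B: "\<forall>i<\<kappa>. cofinal_in (B i) \<kappa>"
    have B_sub: "B i \<subseteq> {..<\<kappa>}" if "i < \<kappa>" for i
      using B that unfolding cofinal_in_def by blast
    have "\<exists>c m. m < \<kappa> \<and> c \<subseteq> {\<xi><..m} \<and> sclosed S \<kappa> c \<and>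
        (\<forall>i<\<xi>. \<exists>\<gamma>\<in>c. \<exists>\<gamma>'\<in>c. hblock (B i) \<xi> c \<gamma> \<gamma>')" if "\<xi> < \<kappa>" for \<xi>
      using all_blocks[of B, OF _ that] B by blast
    then obtain c m where cm: "\<And>\<xi>. \<xi> < \<kappa> \<Longrightarrow> m \<xi> < \<kappa> \<and> c \<xi> \<subseteq> {\<xi><..m \<xi>} \<and> sclosed S \<kappa> (c \<xi>) \<and>
        (\<forall>i<\<xi>. \<exists>\<gamma>\<in>c \<xi>. \<exists>\<gamma>'\<in>c \<xi>. hblock (B i) \<xi> (c \<xi>) \<gamma> \<gamma>')"
      by metis
    define X where "X = {p (i, x) | i x. i < \<kappa> \<and> x \<in> B i}"
    have "X \<subseteq> {..<\<kappa>}"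
      using p_less B_sub unfolding X_def by blast
    have X_iff: "p (i, x) \<in> X \<longleftrightarrow> x \<in> B i" if "i < \<kappa>" "x < \<kappa>" for i x
    proof
      assume "p (i, x) \<in> X"
      then obtain i' x' where i': "p (i, x) = p (i', x')" "i' < \<kappa>" "x' \<in> B i'"
        unfolding X_def by blast
      moreover have "x' < \<kappa>"
        using i' B_sub by blast
      ultimately have "(i, x) = (i', x')"
        using inj_onD[OF p(1), of "(i, x)" "(i', x')"] that by blast
      then show "x \<in> B i"
        using i' by simp
    next
      assume "x \<in> B i"
      then show "p (i, x) \<in> X"
        using that unfolding X_def by blast
    qed
    \<comment> \<open>Closure under \<open>m\<close> keeps the chosen blocks below \<alpha>; closure
      under \<open>q\<close> does the same for the codes of pairs.\<close>
    let ?g = "\<lambda>x. max (m x) (q x)"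
    let ?b = "\<lambda>\<alpha> i. {x. x < \<alpha> \<and> p (i, x) \<in> A \<alpha>}"
    let ?G = "{\<alpha>\<in>{\<alpha>\<in>S. X \<inter> {..<\<alpha>} = A \<alpha>}. limit_ord \<alpha> \<and> (\<forall>x<\<alpha>. ?g x < \<alpha>)}"
    let ?H = "{\<alpha>\<in>S. limit_ord \<alpha> \<and> (\<forall>i<min \<alpha> \<kappa>. ?b \<alpha> i \<subseteq> B i) \<and>
      (\<exists>C. cofinal_in C \<alpha> \<and> sclosed S \<alpha> C \<and> (\<forall>i<min \<alpha> \<kappa>. hits Sigma_lt_infty C (?b \<alpha> i) \<alpha>))}"
    have "?g x < \<kappa>" if "x < \<kappa>" for x
      using cm[OF that] q[OF that] by simp
    then have st: "stationary_in ?G \<kappa>"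
      by (rule stationary_closure[OF A[OF \<open>X \<subseteq> {..<\<kappa>}\<close>]])
    have "?G \<subseteq> ?H"
    proof
      fix \<alpha> assume a: "\<alpha> \<in> ?G"
      then have a': "\<alpha> < \<kappa>" "limit_ord \<alpha>" "X \<inter> {..<\<alpha>} = A \<alpha>"
        using S_sub by auto
      have closed: "m x < \<alpha>" "q x < \<alpha>" if "x < \<alpha>" for x
        using a that by auto
      have b: "?b \<alpha> i = B i \<inter> {..<\<alpha>}" if i: "i < \<alpha>" for i
      proof -
        have "p (i, x) \<in> A \<alpha> \<longleftrightarrow> x \<in> B i" if x: "x < \<alpha>" for x
        proof -
          have mx: "max i x < \<alpha>"
            using i x by simp
          have "p (i, x) < q (max i x)"
            using q[OF less_trans[OF mx a'(1)]] by simp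
          then have "p (i, x) < \<alpha>"
            using closed(2)[OF mx] by (rule less_trans)
          then show ?thesis
            using a'(3) X_iff[OF less_trans[OF i a'(1)] less_trans[OF x a'(1)]] by blast
        qed
        then show ?thesis
          by auto
      qed
      have "m \<xi> < \<alpha> \<and> c \<xi> \<subseteq> {\<xi><..m \<xi>} \<and> sclosed S \<kappa> (c \<xi>) \<and>
          (\<forall>i<\<xi>. \<exists>\<gamma>\<in>c \<xi>. \<exists>\<gamma>'\<in>c \<xi>. hblock (B i) \<xi> (c \<xi>) \<gamma> \<gamma>')" if x: "\<xi> < \<alpha>" for \<xi>
        using cm[OF less_trans[OF x a'(1)]] closed(1)[OF x] by blast
      \<comment> \<open>This club is built from \<open>B\<close> itself. It only witnesses that some
        club hits the guesses at \<alpha>, which is what the choice made in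
        \<open>P_minus_intro\<close> asks for.\<close>
      then obtain C where "cofinal_in C \<alpha>" "sclosed S \<alpha> C"
        "\<forall>i<\<alpha>. hits Sigma_lt_infty C (B i \<inter> {..<\<alpha>}) \<alpha>"
        by (rule club_with_blocks[OF a'(1,2)])
      then show "\<alpha> \<in> ?H"
        using a b by auto
    qed
    then show "stationary_in ?H \<kappa>"
      by (rule stationary_mono[OF st]) (use S_sub in blast)
  qed
qed

end

theorem theorem4p26:
  fixes \<kappa> :: "'a::wellorder" and S :: "'a set"
  assumes "strongly_inaccessible \<kappa>"
    and "stationary_in S \<kappa>"
    and "nonreflecting \<kappa> S"
    and "diamond \<kappa> S"
  shows "P_minus \<kappa> S (osuc ozero) (Sigma_ord \<kappa>) \<and> P_minus \<kappa> S \<kappa> Sigma_lt_infty"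
proof -
  interpret nonreflecting_inaccessible \<kappa> S
    using assms unfolding stationary_in_def by unfold_locales blast+
  show ?thesis
    using guessed_single guessed_sequence assms(4) by blast
qed

end
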